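(* Suppose the objective $F$ and the stochastic gradients satisfy the lower boundedness, joint $(\mathcal L_0,\mathcal L_1,q)$-smoothness and layer-wise variance assumptions stated in the context, and that layer-wise Muon (see context) is run with the $J$-step Frobenius-normalized Newton--Schulz map described in the context, whose scalar map $\phi_J$ satisfies $$\ell_J:=\inf_{0<s\le1}\frac{\phi_J(s)}{s}>0,\qquad u_J:=\sup_{0<s\le1}\frac{\phi_J(s)}{s}<\infty .$$ Fix $\gamma_0,\delta_0>0$ and $a>1/2$, and for horizon $T$ set $$\gamma=\gamma_0T^{-3/4},\qquad 1-\beta_1=\delta_0T^{-1/2},\qquad \beta_2=1-(1-\beta_1)^a .$$ Put $D=F(X_1)-F^*$, $S_{\mathsf F}=\sum_{l=1}^L\sigma_{(l)}$, $G_{\mathsf F}=\sum_{l=1}^L\|\nabla_{(l)}F(X_1)\|_{\mathsf F}$, $\hat{\mathcal L}=\mathcal L_0+(1-q)\mathcal L_1$, $b_J=\ell_J+u_J$. Then for all sufficiently large $T$ one has $\beta_1,\beta_2\in[0,1]$, $$\ell_J-\frac{\gamma L u_J^2 q\mathcal L_1}{2}-\frac{\gamma L u_J(\ell_J+u_J)q\mathcal L_1}{1-\beta_1}\ \ge\ \frac{\ell_J}{2},$$ and the iterates satisfy $$\begin{aligned} \frac1T\sum_{t=1}^T\sum_{l=1}^L\mathbb E\|\nabla_{(l)}F(X_t)\|_{\mathsf F} \le\frac{2}{\ell_J}\Bigg[&\left(\frac D{\gamma_0}+b_JS_{\mathsf F}\sqrt{\delta_0}+\frac{\gamma_0L u_J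 b_J\hat{\mathcal L}}{\delta_0}\right)T^{-1/4}+\frac{b_JG_{\mathsf F}}{\delta_0T^{1/2}}\\ &+\sqrt2\, b_JS_{\mathsf F}\left(\frac{\delta_0^{(1+a)/2}}{T^{(1+a)/4}}+\frac{\delta_0^a}{T^{a/2}}\right)+\frac{\gamma_0L u_J^2\hat{\mathcal L}}{2T^{3/4}}\Bigg]. \end{aligned}$$ The same upper bound holds for $\frac1T\sum_{t=1}^T\mathbb E\|\nabla F(X_t)\|_{\mathsf F}$. (The right-hand side contains no matrix dimension $n_l$, $m_l$, no rank, and no total dimension $\sum_l n_lm_l$.)
   Context: Parameter space: $\mathcal S=\mathbb R^{n_1\times m_1}\times\cdots\times\mathbb R^{n_L\times m_L}$; $X=(X^{(1)},\dots,X^{(L)})$, with $\|X\|_{\mathsf F}^2=\sum_{l=1}^L\|X^{(l)}\|_{\mathsf F}^2$ ($\|\cdot\|_{\mathsf F}$ is the Frobenius norm). The objective is $F(X)=\mathbb E_\xi[f(X;\xi)]$; $\nabla_{(l)}$ denotes the gradient block with respect to $X^{(l)}$. Assumptions. (Lower boundedness) There is $F^*>-\infty$ with $F(X)\ge F^*$ for all $X\in\mathcal S$. (Joint smoothness) $F:\mathcal S\to\mathbb R$ is differentiable and, for some $\mathcal L_0>0$, $\mathcal L_1\ge0$, $q\in[0,1]$ and all $X,Y\in\mathcal S$, $\|\nabla F(X)-\nabla F(Y)\|_{\mathsf F}\le(\mathcal L_0+\mathcal L_1\|\nabla F(X)\|_{\mathsf F}^q)\|X-Y\|_{\mathsf F}$;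 for $q=0$ the power is interpreted as $1$, including at a zero gradient. (Layer-wise variance) For each $l$ there is $\sigma_{(l)}\ge0$ such that for all $X\in\mathcal S$: $\mathbb E_\xi[\nabla_{(l)}f(X;\xi)]=\nabla_{(l)}F(X)$ and $\mathbb E_\xi\|\nabla_{(l)}f(X;\xi)-\nabla_{(l)}F(X)\|_{\mathsf F}^2\le\sigma_{(l)}^2$. At iteration $t$, the sample $\xi_t$ is independent of the past $\mathcal F_{t-1}$ (the $\sigma$-field of the history before step $t$, with respect to which $X_t$ is measurable), so the same statements hold conditionally on $\mathcal F_{t-1}$ at $X=X_t$. Noise in different layers need not be independent. Algorithm (layer-wise Muon, horizon $T$). $X_1\in\mathcal S$ is a given deterministic point and $M_0^{(l)}=0$. For $t=1,\dots,T$ and each $l=1,\dots,L$: $G_t^{(l)}=\nabla_{(l)}f(X_t;\xi_t)$; $M_t^{(l)}=\beta_1M_{t-1}^{(l)}+(1-\beta_1)G_t^{(l)}$; $N_t^{(l)}=\beta_2M_t^{(l)}+(1-\beta_2)G_t^{(l)}$; $O_t^{(l)}=$ orthogonalization routine applied to $N_t^{(l)}$; $X_{t+1}^{(l)}=X_t^{(l)}-\gamma O_t^{(l)}$. All gradient blocks at step $t$ are evaluated at the same $X_t$. The parameters $\gamma,\beta_1,\beta_2$ are constant during the run but depend on $T$. Newton--Schulz routine. Fix $J\ge1$ and real coefficients $(a_j,b_j,c_j)_{j=1}^J$ (independent of $T$ and of matrix sizes). For a matrix $N\ne0$ put $Z_0=N/\|N\|_{\mathsf F}$, $Z_j=a_jZ_{j-1}+b_j(Z_{j-1}Z_{j-1}^\top)Z_{j-1}+c_j(Z_{j-1}Z_{j-1}^\top)^2Z_{j-1}$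 for $j=1,\dots,J$, and output $O=Z_J$; for $N=0$ output $O=0$. The associated scalar map is $\phi_J=p_J\circ\cdots\circ p_1$ with $p_j(s)=a_js+b_js^3+c_js^5$. Exact arithmetic is assumed. *)

theory Defs
  imports "HOL-Probability.Probability"
begin

text \<open>
  The blocks of a parameter have different sizes.  Layer \<open>l\<close> holds a real matrix whose rows are
  indexed by a finite set \<open>rowset l\<close> and whose columns are indexed by a finite set \<open>colset l\<close>
  (so \<open>n_l = card (rowset l)\<close>, \<open>m_l = card (colset l)\<close>, and the number of layers is the cardinality
  of the type \<open>'l\<close>).  All blocks are stored in one matrix type by filling up with zeros outside
  \<open>rowset l \<times> colset l\<close>; the product space of the blocks is then a linear subspace of
  \<^typ>\<open>real ^ 'm ^ 'n ^ 'l\<close>.  Every choice of layer number and block sizes arises from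
  suitable finite types and index sets.  Filling up with zeros changes neither matrix products and
  transposes nor norms: the norm of \<^typ>\<open>real ^ 'm ^ 'n\<close> is the Frobenius norm, and the
  norm of \<^typ>\<open>real ^ 'm ^ 'n ^ 'l\<close> is the square root of the sum of the squared Frobenius
  norms of the blocks.
\<close>

definition param_space ::
  "('l::finite \<Rightarrow> 'n::finite set) \<Rightarrow> ('l \<Rightarrow> 'm::finite set) \<Rightarrow> (real ^ 'm ^ 'n ^ 'l) set" where
  "param_space rowset colset =
     {X. \<forall>l i j. (i \<notin> rowset l \<or> j \<notin> colset l) \<longrightarrow> X $ l $ i $ j = 0}"

lemma subspace_param_space: "subspace (param_space rowset colset)"
  by (auto simp: subspace_def param_space_def)

text \<open>
  The gradient at \<open>X\<close> of a function on a linear subspace \<open>S\<close>: the vector of \<open>S\<close> that represents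
  the Frechet derivative relative to \<open>S\<close>.  Values of \<open>h\<close> outside \<open>S\<close> play no role.  For
  \<open>S = param_space rowset colset\<close>, the gradient block of layer \<open>l\<close> is \<open>gradient_on S h X $ l\<close>.
\<close>

definition gradient_on :: "'a::real_inner set \<Rightarrow> ('a \<Rightarrow> real) \<Rightarrow> 'a \<Rightarrow> 'a" where
  "gradient_on S h X =
     (THE g. g \<in> S \<and> (h has_derivative (\<lambda>H. g \<bullet> H)) (at X within S))"

lemma gradient_on_unique:
  fixes S :: "'a::real_inner set"
  assumes S: "subspace S" and X: "X \<in> S"
    and g: "g \<in> S" "(h has_derivative (\<lambda>H. g \<bullet> H)) (at X within S)"
    and g': "g' \<in> S" "(h has_derivative (\<lambda>H. g' \<bullet> H)) (at X within S)"
  shows "g = g'"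
proof -
  define d where "d = g - g'"
  have dS: "d \<in> S" unfolding d_def using S g(1) g'(1) by (rule subspace_diff)
  have "((\<lambda>Y. h Y - h Y) has_derivative (\<lambda>H. g \<bullet> H - g' \<bullet> H)) (at X within S)"
    using g(2) g'(2) by (rule has_derivative_diff)
  then have 0: "((\<lambda>Y. 0::real) has_derivative (\<lambda>H. d \<bullet> H)) (at X within S)"
    by (simp add: d_def inner_diff_left)
  have line: "((\<lambda>t::real. X + t *\<^sub>R d) has_derivative (\<lambda>t. t *\<^sub>R d)) (at 0)"
    by (auto intro!: derivative_eq_intros)
  have sub: "range (\<lambda>t::real. X + t *\<^sub>R d) \<subseteq> S"
    using S X dS by (auto intro!: subspace_add subspace_scale)
  have "((\<lambda>t::real. 0::real) has_derivative (\<lambda>t. d \<bullet> (t *\<^sub>R d))) (at 0)"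
    using has_derivative_in_compose[of "\<lambda>t::real. X + t *\<^sub>R d" "\<lambda>t. t *\<^sub>R d" 0 UNIV
        "\<lambda>_. 0::real" "\<lambda>H. d \<bullet> H"] line has_derivative_subset[OF 0 sub] by simp
  then have "(\<lambda>t::real. d \<bullet> (t *\<^sub>R d)) = (\<lambda>t. 0)"
    using has_derivative_unique has_derivative_const by blast
  from fun_cong[OF this, of 1] show ?thesis by (simp add: d_def)
qed

lemma gradient_on_exists:
  fixes S :: "'a::euclidean_space set"
  assumes S: "subspace S" and X: "X \<in> S" and h: "h differentiable (at X within S)"
  shows "\<exists>g. g \<in> S \<and> (h has_derivative (\<lambda>H. g \<bullet> H)) (at X within S)"
proof -
  obtain D where D: "(h has_derivative D) (at X within S)"
    using h by (auto simp: differentiable_def)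
  have lin: "linear D" using D by (rule has_derivative_linear)
  obtain g z where g: "g \<in> span S" and z: "\<And>w. w \<in> span S \<Longrightarrow> orthogonal z w"
    and gz: "adjoint D 1 = g + z"
    using orthogonal_subspace_decomp_exists[of S "adjoint D 1"] by metis
  have gS: "g \<in> S" using g S by (simp add: span_eq_iff[THEN iffD2])
  have eq: "D H = g \<bullet> H" if "H \<in> S" for H
  proof -
    have "D H = adjoint D 1 \<bullet> H"
      using adjoint_works[OF lin, of H 1] by (simp add: inner_commute)
    also have "z \<bullet> H = 0" using z[of H] that by (simp add: span_base orthogonal_def)
    then have "adjoint D 1 \<bullet> H = g \<bullet> H" by (simp add: gz inner_add_left)
    finally show ?thesis .
  qed
  have "(h has_derivative (\<lambda>H. g \<bullet> H)) (at X within S)"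
    unfolding has_derivative_within
  proof
    show "bounded_linear ((\<bullet>) g)" by (rule bounded_linear_inner_right)
    have "((\<lambda>y. (1 / norm (y - X)) *\<^sub>R (h y - (h X + D (y - X)))) \<longlongrightarrow> 0) (at X within S)"
      using D by (simp add: has_derivative_within)
    then show "((\<lambda>y. (1 / norm (y - X)) *\<^sub>R (h y - (h X + g \<bullet> (y - X)))) \<longlongrightarrow> 0)
        (at X within S)"
    proof (rule Lim_transform_eventually)
      show "\<forall>\<^sub>F y in at X within S. (1 / norm (y - X)) *\<^sub>R (h y - (h X + D (y - X)))
          = (1 / norm (y - X)) *\<^sub>R (h y - (h X + g \<bullet> (y - X)))"
        unfolding eventually_at_filter
        by (intro always_eventually allI impI) (simp add: eq subspace_diff[OF S _ X])
    qed
  qed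
  with gS show ?thesis by blast
qed

lemma gradient_on_works:
  fixes S :: "'a::euclidean_space set"
  assumes "subspace S" "X \<in> S" "h differentiable (at X within S)"
  shows "gradient_on S h X \<in> S"
    and "(h has_derivative (\<lambda>H. gradient_on S h X \<bullet> H)) (at X within S)"
proof -
  have "\<exists>!g. g \<in> S \<and> (h has_derivative (\<lambda>H. g \<bullet> H)) (at X within S)"
    using gradient_on_exists[OF assms] gradient_on_unique[OF assms(1,2)] by blast
  from theI'[OF this] show "gradient_on S h X \<in> S"
    and "(h has_derivative (\<lambda>H. gradient_on S h X \<bullet> H)) (at X within S)"
    by (auto simp: gradient_on_def)
qed

text \<open>
  \<open>0 powr 0 = 0\<close> in the library, whereas here the zeroth power is \<open>1\<close> also at a zero gradient.
\<close>

definition grad_power :: "real \<Rightarrow> real \<Rightarrow> real" where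
  "grad_power x q = (if q = 0 then 1 else x powr q)"

definition joint_smooth ::
  "'a::real_inner set \<Rightarrow> ('a \<Rightarrow> real) \<Rightarrow> real \<Rightarrow> real \<Rightarrow> real \<Rightarrow> bool" where
  "joint_smooth S F L0 L1 q \<longleftrightarrow>
     L0 > 0 \<and> L1 \<ge> 0 \<and> 0 \<le> q \<and> q \<le> 1 \<and>
     (\<forall>X\<in>S. F differentiable (at X within S)) \<and>
     (\<forall>X\<in>S. \<forall>Y\<in>S.
        norm (gradient_on S F X - gradient_on S F Y)
          \<le> (L0 + L1 * grad_power (norm (gradient_on S F X)) q) * norm (X - Y))"

text \<open>
  The law of a sample is \<open>\<mu>\<close> and the loss of the sample \<open>x\<close> at the parameter \<open>X\<close> is \<open>f X x\<close>.
\<close>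

definition stochastic_objective ::
  "'a::real_inner set \<Rightarrow> 'x measure \<Rightarrow> ('a \<Rightarrow> 'x \<Rightarrow> real) \<Rightarrow> ('a \<Rightarrow> real) \<Rightarrow> bool" where
  "stochastic_objective S \<mu> f F \<longleftrightarrow>
     prob_space \<mu> \<and>
     (\<forall>X\<in>S. integrable \<mu> (f X) \<and> F X = (\<integral>x. f X x \<partial>\<mu>)) \<and>
     (\<forall>x\<in>space \<mu>. \<forall>X\<in>S. (\<lambda>Y. f Y x) differentiable (at X within S))"

text \<open>
  The integrability clauses are part of the meaning of the two expectations, since the Bochner
  integral of a non-integrable function is \<open>0\<close>.
\<close>

definition layerwise_variance ::
  "(real ^ 'm::finite ^ 'n::finite ^ 'l::finite) set \<Rightarrow> 'x measure \<Rightarrow>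
    (real ^ 'm ^ 'n ^ 'l \<Rightarrow> 'x \<Rightarrow> real) \<Rightarrow> (real ^ 'm ^ 'n ^ 'l \<Rightarrow> real) \<Rightarrow> ('l \<Rightarrow> real) \<Rightarrow> bool" where
  "layerwise_variance S \<mu> f F \<sigma> \<longleftrightarrow>
     (\<forall>l. \<sigma> l \<ge> 0 \<and>
       (\<forall>X\<in>S.
          integrable \<mu> (\<lambda>x. gradient_on S (\<lambda>Y. f Y x) X $ l) \<and>
          (\<integral>x. gradient_on S (\<lambda>Y. f Y x) X $ l \<partial>\<mu>) = gradient_on S F X $ l \<and>
          integrable \<mu>
            (\<lambda>x. (norm (gradient_on S (\<lambda>Y. f Y x) X $ l - gradient_on S F X $ l))\<^sup>2) \<and>
          (\<integral>x. (norm (gradient_on S (\<lambda>Y. f Y x) X $ l - gradient_on S F X $ l))\<^sup>2 \<partial>\<mu>)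
            \<le> (\<sigma> l)\<^sup>2))"

text \<open>
  \<open>H t\<close> is the \<open>\<sigma>\<close>-field of the history up to and including step \<open>t\<close>.  It may be larger than the
  one generated by the samples \<open>\<xi> 1, ..., \<xi> t\<close>.  The iterate of step \<open>t\<close> is a function of the
  samples of the earlier steps, hence measurable with respect to \<open>H (t - 1)\<close>.
\<close>

definition fresh_samples ::
  "'w measure \<Rightarrow> (nat \<Rightarrow> 'w measure) \<Rightarrow> 'x measure \<Rightarrow> nat \<Rightarrow> (nat \<Rightarrow> 'w \<Rightarrow> 'x) \<Rightarrow> bool" where
  "fresh_samples P H \<mu> T \<xi> \<longleftrightarrow>
     prob_space P \<and> filtration (space P) H \<and> (\<forall>t. subalgebra P (H t)) \<and>
     (\<forall>t\<in>{1..T}.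
        \<xi> t \<in> measurable (H t) \<mu> \<and>
        distr P \<mu> (\<xi> t) = \<mu> \<and>
        prob_space.indep_set P (sets (H (t - 1))) {\<xi> t -` A \<inter> space P | A. A \<in> sets \<mu>})"

primrec ns_iter ::
  "(nat \<Rightarrow> real) \<Rightarrow> (nat \<Rightarrow> real) \<Rightarrow> (nat \<Rightarrow> real) \<Rightarrow> nat \<Rightarrow>
    real ^ 'm::finite ^ 'n::finite \<Rightarrow> real ^ 'm ^ 'n" where
  "ns_iter a b c 0 Z = Z"
| "ns_iter a b c (Suc j) Z =
     (let W = ns_iter a b c j Z; A = W ** transpose W in
        a (Suc j) *\<^sub>R W + b (Suc j) *\<^sub>R (A ** W) + c (Suc j) *\<^sub>R ((A ** A) ** W))"

definition newton_schulz ::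
  "(nat \<Rightarrow> real) \<Rightarrow> (nat \<Rightarrow> real) \<Rightarrow> (nat \<Rightarrow> real) \<Rightarrow> nat \<Rightarrow>
    real ^ 'm::finite ^ 'n::finite \<Rightarrow> real ^ 'm ^ 'n" where
  "newton_schulz a b c J N = (if N = 0 then 0 else ns_iter a b c J ((1 / norm N) *\<^sub>R N))"

primrec ns_scalar ::
  "(nat \<Rightarrow> real) \<Rightarrow> (nat \<Rightarrow> real) \<Rightarrow> (nat \<Rightarrow> real) \<Rightarrow> nat \<Rightarrow> real \<Rightarrow> real" where
  "ns_scalar a b c 0 s = s"
| "ns_scalar a b c (Suc j) s =
     (let r = ns_scalar a b c j s in
        a (Suc j) * r + b (Suc j) * r ^ 3 + c (Suc j) * r ^ 5)"

text \<open>
  The process \<open>X\<close> is produced by \<open>T\<close> steps of layer-wise Muon on the sample space \<open>\<Omega>\<close>.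
\<close>

definition muon_run ::
  "(real ^ 'm::finite ^ 'n::finite ^ 'l::finite) set \<Rightarrow> (real ^ 'm ^ 'n ^ 'l \<Rightarrow> 'x \<Rightarrow> real) \<Rightarrow>
    (real ^ 'm ^ 'n \<Rightarrow> real ^ 'm ^ 'n) \<Rightarrow> real \<Rightarrow> real \<Rightarrow> real \<Rightarrow> nat \<Rightarrow> real ^ 'm ^ 'n ^ 'l \<Rightarrow>
    'w set \<Rightarrow> (nat \<Rightarrow> 'w \<Rightarrow> 'x) \<Rightarrow> (nat \<Rightarrow> 'w \<Rightarrow> real ^ 'm ^ 'n ^ 'l) \<Rightarrow> bool" where
  "muon_run S f orth \<gamma> \<beta>1 \<beta>2 T X1 \<Omega> \<xi> X \<longleftrightarrow>
     (\<exists>G M N Q :: nat \<Rightarrow> 'w \<Rightarrow> real ^ 'm ^ 'n ^ 'l. \<forall>\<omega>\<in>\<Omega>.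
        X 1 \<omega> = X1 \<and> M 0 \<omega> = 0 \<and>
        (\<forall>t\<in>{1..T}. \<forall>l.
           G t \<omega> $ l = gradient_on S (\<lambda>Y. f Y (\<xi> t \<omega>)) (X t \<omega>) $ l \<and>
           M t \<omega> $ l = \<beta>1 *\<^sub>R (M (t - 1) \<omega> $ l) + (1 - \<beta>1) *\<^sub>R (G t \<omega> $ l) \<and>
           N t \<omega> $ l = \<beta>2 *\<^sub>R (M t \<omega> $ l) + (1 - \<beta>2) *\<^sub>R (G t \<omega> $ l) \<and>
           Q t \<omega> $ l = orth (N t \<omega> $ l) \<and>
           X (t + 1) \<omega> $ l = X t \<omega> $ l - \<gamma> *\<^sub>R (Q t \<omega> $ l)))"

end

theory Submission
  imports Defs
begin

text \<open>
  The Newton--Schulz output \<open>Q\<close> for \<open>N\<close> has the singular vectors of \<open>N\<close>, with the singular values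
  \<open>s\<close> of the normalized matrix moved to \<open>\<phi>\<^sub>J s\<close>, between \<open>\<l> s\<close> and \<open>u s\<close>.  Hence \<open>\<l> \<parallel>N\<parallel> \<le> \<langle>N, Q\<rangle>\<close> and
  \<open>\<parallel>Q\<parallel> \<le> u\<close> without any dimension factor, and along the gradient \<open>g\<close> the step gains
  \<open>\<l> \<parallel>g\<parallel> - (\<l> + u) \<parallel>N - g\<parallel>\<close>.  The error \<open>N - g\<close> splits into the initial gradient, discounted
  geometrically, the drift of the gradient along the run, which joint smoothness bounds by the step
  length, and an exponential average \<open>V\<close> of the noise.  The recursion
  \<open>V\<^sub>t = \<beta>\<^sub>1 V\<^sub>t\<^sub>-\<^sub>1 + (1 - \<beta>\<^sub>1) n\<^sub>t\<close> with \<open>n\<^sub>t\<close> uncorrelated to the past keeps \<open>E \<parallel>V\<^sub>t\<parallel>\<^sup>2\<close> below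
  \<open>(1 - \<beta>\<^sub>1) \<sigma>\<^sup>2\<close>, since \<open>\<beta>\<^sub>1\<^sup>2 + (1 - \<beta>\<^sub>1) \<le> 1\<close>.  The descent inequality is telescoped pathwise and
  only then integrated, so no integrability of \<open>F (X\<^sub>t)\<close> is needed.
\<close>

subsection \<open>Spectral theorem for self-adjoint maps\<close>

text \<open>A maximizer of the quadratic form of \<open>A\<close> on the unit sphere of
  \<open>W\<close> is an eigenvector. Working inside an invariant subspace lets eigenvectors be
  split off one after another.\<close>

lemma selfadjoint_eigenvector_exists:
  fixes A :: "'a::euclidean_space \<Rightarrow> 'a"
  assumes lin: "linear A" and sym: "\<And>x y. A x \<bullet> y = x \<bullet> A y"
    and W: "subspace W" "W \<noteq> {0}" and inv: "A ` W \<subseteq> W"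
  obtains v c where "v \<in> W" "norm v = 1" "A v = c *\<^sub>R v"
proof -
  define K where "K = sphere 0 1 \<inter> W"
  have "compact K"
    unfolding K_def by (intro compact_Int_closed compact_sphere closed_subspace W)
  obtain w where w: "w \<in> W" "w \<noteq> 0"
    using W subspace_0 by blast
  then have "(1 / norm w) *\<^sub>R w \<in> K"
    using W(1) by (auto simp: K_def subspace_scale)
  then have "K \<noteq> {}" by blast
  have "continuous_on K (\<lambda>x. x \<bullet> A x)"
    by (intro continuous_intros linear_continuous_on linear_conv_bounded_linear[THEN iffD1] lin)
  with \<open>compact K\<close> \<open>K \<noteq> {}\<close> obtain v where v: "v \<in> K"
    and max: "\<And>x. x \<in> K \<Longrightarrow> x \<bullet> A x \<le> v \<bullet> A v"
    by (metis continuous_attains_sup)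
  define c where "c = v \<bullet> A v"
  have vW: "v \<in> W" "norm v = 1" using v by (auto simp: K_def)
  \<comment> \<open>A nonnegative quadratic form on \<open>W\<close> that vanishes at \<open>v\<close>, so its gradient at \<open>v\<close> is zero.\<close>
  have quad: "0 \<le> c * (x \<bullet> x) - x \<bullet> A x" if "x \<in> W" for x
  proof (cases "x = 0")
    case False
    define y where "y = (1 / norm x) *\<^sub>R x"
    have "y \<in> K" using False that W(1) by (auto simp: K_def y_def subspace_scale)
    then have "y \<bullet> A y \<le> c" using max c_def by blast
    moreover have "x = norm x *\<^sub>R y" using False by (simp add: y_def)
    then have "x \<bullet> A x = (norm x)\<^sup>2 * (y \<bullet> A y)"
      by (metis inner_scaleR_left inner_scaleR_right lin linear_scale mult.assoc power2_eq_square)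
    ultimately show ?thesis
      by (simp add: power2_norm_eq_inner mult.commute[of c] mult_left_mono)
  qed (simp add: linear_0[OF lin])
  define z where "z = c *\<^sub>R v - A v"
  have zW: "z \<in> W"
    unfolding z_def using vW inv W(1) by (intro subspace_diff subspace_scale) auto
  have "z \<bullet> z = 0"
  proof (rule ccontr)
    assume nz: "z \<bullet> z \<noteq> 0"
    define Qz where "Qz = c * (z \<bullet> z) - z \<bullet> A z"
    have line: "0 \<le> 2 * t * (z \<bullet> z) + t\<^sup>2 * Qz" for t
    proof -
      have "0 \<le> c * ((v + t *\<^sub>R z) \<bullet> (v + t *\<^sub>R z)) - (v + t *\<^sub>R z) \<bullet> A (v + t *\<^sub>R z)"
        by (intro quad subspace_add subspace_scale W vW zW)
      also have "\<dots> = (c * (v \<bullet> v) - v \<bullet> A v) + 2 * t * (z \<bullet> (c *\<^sub>R v - A v)) + t\<^sup>2 * Qz"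
        using sym[of v z]
        by (simp add: linear_add[OF lin] linear_scale[OF lin] Qz_def inner_simps inner_commute
            algebra_simps power2_eq_square)
      also have "c * (v \<bullet> v) - v \<bullet> A v = 0"
        using vW by (simp add: c_def flip: power2_norm_eq_inner)
      finally show ?thesis by (simp add: z_def)
    qed
    have zz: "0 < z \<bullet> z" using nz by (simp add: less_le)
    \<comment> \<open>The linear term of \<open>line\<close> must vanish, as otherwise some negative
      \<open>t\<close> makes the form negative. If \<open>Qz\<close> is positive, the minimizer
      \<open>t = - (z \<bullet> z) / Qz\<close> serves; otherwise \<open>t = -1\<close>
      does.\<close>
    show False
    proof (cases "Qz \<le> 0")
      case True
      then show False using line[of "-1"] zz by simp
    next
      case False
      then show False
        using line[of "- ((z \<bullet> z) / Qz)"] zz mult_pos_pos[OF zz zz]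
        by (simp add: power2_eq_square field_simps not_le mult_less_0_iff zero_less_mult_iff)
    qed
  qed
  then have "A v = c *\<^sub>R v" by (simp add: z_def)
  with vW show thesis by (rule that)
qed

text \<open>Take an orthonormal set of eigenvectors of largest cardinality, which exists because the
  dimension bounds it. By symmetry its orthogonal complement is invariant, so a nonzero complement
  would supply one more eigenvector.\<close>

theorem selfadjoint_orthonormal_eigenbasis:
  fixes A :: "'a::euclidean_space \<Rightarrow> 'a"
  assumes lin: "linear A" and sym: "\<And>x y. A x \<bullet> y = x \<bullet> A y"
  obtains B c where "finite B" "pairwise orthogonal B" "\<And>v. v \<in> B \<Longrightarrow> norm v = 1"
    "span B = UNIV" "\<And>v. v \<in> B \<Longrightarrow> A v = c v *\<^sub>R v"
proof -
  define good where "good B \<longleftrightarrow> pairwise orthogonal B \<and> (\<forall>v\<in>B. norm v = 1 \<and> (\<exists>c. A v = c *\<^sub>R v))" for B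
  have indep: "finite B \<and> card B \<le> DIM('a)" if "good B" for B
  proof -
    have "0 \<notin> B" using that by (auto simp: good_def)
    then show ?thesis
      using that pairwise_orthogonal_independent independent_bound by (auto simp: good_def)
  qed
  have "good {}" by (simp add: good_def)
  then obtain B where B: "good B" and max: "\<And>C. good C \<Longrightarrow> card C \<le> card B"
    using ex_has_greatest_nat[of good "{}" card "Suc DIM('a)"] indep by (metis less_Suc_eq_le)
  define W where "W = {x. \<forall>v\<in>B. orthogonal v x}"
  have W: "subspace W"
    by (auto simp: W_def subspace_def orthogonal_def inner_simps)
  have "A ` W \<subseteq> W"
  proof clarify
    fix x assume x: "x \<in> W"
    show "A x \<in> W"
      unfolding W_def orthogonal_def
    proof clarify
      fix v assume v: "v \<in> B"
      then obtain c where "A v = c *\<^sub>R v" using B by (auto simp: good_def)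
      then show "v \<bullet> A x = 0"
        using x v sym[of v x] by (simp add: W_def orthogonal_def)
    qed
  qed
  have "W = {0}"
  proof (rule ccontr)
    assume "W \<noteq> {0}"
    then obtain v c where v: "v \<in> W" "norm v = 1" "A v = c *\<^sub>R v"
      using selfadjoint_eigenvector_exists[OF lin sym W _ \<open>A ` W \<subseteq> W\<close>] by metis
    have "v \<notin> B" using v by (auto simp: W_def orthogonal_def)
    have "good (insert v B)"
      using B v by (auto simp: good_def pairwise_insert W_def orthogonal_commute)
    then show False using max[of "insert v B"] indep[OF B] \<open>v \<notin> B\<close> by simp
  qed
  have "span B = UNIV"
  proof (rule ccontr)
    assume "span B \<noteq> UNIV"
    then obtain x where x: "x \<noteq> 0" "\<And>y. y \<in> span B \<Longrightarrow> orthogonal x y"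
      using orthogonal_to_subspace_exists_gen[of B UNIV] by (auto simp: psubset_eq)
    then have "x \<in> W" by (auto simp: W_def span_base orthogonal_commute)
    with x \<open>W = {0}\<close> show False by simp
  qed
  moreover obtain c where "\<And>v. v \<in> B \<Longrightarrow> A v = c v *\<^sub>R v"
    using B by (auto simp: good_def) metis
  ultimately show thesis
    using that[of B c] B indep[OF B] by (simp add: good_def)
qed

text \<open>The difference of the two sides lies in \<open>span B\<close> and is orthogonal to
  \<open>B\<close>, hence to itself. The span may be a proper subspace: measurability of gradients
  uses this with a basis of the parameter space.\<close>

lemma orthonormal_expansion:
  fixes x :: "'a::euclidean_space"
  assumes "finite B" "pairwise orthogonal B" "\<And>v. v \<in> B \<Longrightarrow> norm v = 1" "x \<in> span B"
  shows "x = (\<Sum>v\<in>B. (v \<bullet> x) *\<^sub>R v)"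
proof -
  define z where "z = (\<Sum>v\<in>B. (v \<bullet> x) *\<^sub>R v)"
  have "orthogonal (x - z) w" if "w \<in> span B" for w
    using that
  proof (rule orthogonal_to_span)
    fix v assume v: "v \<in> B"
    have "(\<Sum>w\<in>B. (w \<bullet> x) * (w \<bullet> v)) = (\<Sum>w\<in>B. if w = v then v \<bullet> x else 0)"
      using assms(2,3) v
      by (intro sum.cong) (auto simp: pairwise_def orthogonal_def norm_eq_1)
    then show "orthogonal (x - z) v"
      using assms(1) v
      by (simp add: orthogonal_def z_def inner_diff_left inner_sum_left inner_commute[of x])
  qed
  moreover have "z \<in> span B" unfolding z_def by (intro span_sum span_scale span_base)
  then have "x - z \<in> span B" using assms(4) by (rule span_diff[rotated])
  ultimately have "orthogonal (x - z) (x - z)" by blast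
  then show ?thesis by (simp add: orthogonal_self z_def)
qed

lemma orthonormal_basis_inner:
  fixes x y :: "'a::euclidean_space"
  assumes "finite B" "pairwise orthogonal B" "\<And>v. v \<in> B \<Longrightarrow> norm v = 1" "span B = UNIV"
  shows "x \<bullet> y = (\<Sum>v\<in>B. (v \<bullet> x) * (v \<bullet> y))"
proof -
  have "x \<bullet> y = (\<Sum>v\<in>B. (v \<bullet> x) *\<^sub>R v) \<bullet> y"
    using orthonormal_expansion[of B x] assms by simp
  then show ?thesis by (simp add: inner_sum_left)
qed

text \<open>This is Parseval's identity for each column, summed over the columns. It lets two
  matrices be compared one left vector \<open>v\<close> at a time.\<close>

lemma matrix_inner_orthonormal_basis:
  fixes M N :: "real ^ 'm::finite ^ 'n::finite"
  assumes B: "finite B" "pairwise orthogonal B" "\<And>v. v \<in> B \<Longrightarrow> norm v = 1" "span B = UNIV"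
  shows "M \<bullet> N = (\<Sum>v\<in>B. (v v* M) \<bullet> (v v* N))"
proof -
  have "M \<bullet> N = (\<Sum>j\<in>UNIV. column j M \<bullet> column j N)"
    by (simp add: inner_vec_def column_def) (rule sum.swap)
  also have "\<dots> = (\<Sum>j\<in>UNIV. \<Sum>v\<in>B. (v \<bullet> column j M) * (v \<bullet> column j N))"
    by (intro sum.cong refl orthonormal_basis_inner B)
  also have "\<dots> = (\<Sum>v\<in>B. \<Sum>j\<in>UNIV. (v \<bullet> column j M) * (v \<bullet> column j N))"
    by (rule sum.swap)
  also have "\<dots> = (\<Sum>v\<in>B. (v v* M) \<bullet> (v v* N))"
    by (simp add: inner_vec_def column_def vector_matrix_mult_def mult.commute)
  finally show ?thesis .
qed

subsection \<open>The Newton--Schulz map on singular pairs\<close>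

text \<open>
  \<open>(v, r)\<close> is a singular pair of \<open>Z\<close> for the singular value \<open>s\<close>, except that \<open>r = 0\<close> is allowed
  when \<open>s = 0\<close>; this covers the kernel of the transpose of \<open>Z\<close>.
\<close>

lemma ns_iter_singular_pair:
  fixes Z :: "real ^ 'm::finite ^ 'n::finite"
  assumes "v v* Z = s *\<^sub>R r" and "Z *v r = s *\<^sub>R v"
  shows "v v* ns_iter a b c j Z = ns_scalar a b c j s *\<^sub>R r
    \<and> ns_iter a b c j Z *v r = ns_scalar a b c j s *\<^sub>R v"
proof (induction j)
  case (Suc j)
  define W where "W = ns_iter a b c j Z"
  define A where "A = W ** transpose W"
  define t where "t = ns_scalar a b c j s"
  have IH: "v v* W = t *\<^sub>R r" "W *v r = t *\<^sub>R v"
    using Suc by (auto simp: W_def t_def)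
  have Av: "A *v v = t\<^sup>2 *\<^sub>R v"
    by (simp add: A_def IH matrix_vector_mult_scaleR power2_eq_square flip: matrix_vector_mul_assoc)
  have vA: "v v* A = t\<^sup>2 *\<^sub>R v"
    by (simp add: A_def IH matrix_vector_mult_scaleR power2_eq_square flip: vector_matrix_mul_assoc)
  have "v v* (a (Suc j) *\<^sub>R W + b (Suc j) *\<^sub>R (A ** W) + c (Suc j) *\<^sub>R ((A ** A) ** W))
      = (a (Suc j) * t + b (Suc j) * t ^ 3 + c (Suc j) * t ^ 5) *\<^sub>R r"
    by (simp add: vector_matrix_mult_add_rdistrib vector_scaleR_matrix_ac
        scaleR_vector_matrix_assoc IH vA
        flip: vector_matrix_mul_assoc)
       (simp add: algebra_simps power2_eq_square eval_nat_numeral)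
  moreover have "(a (Suc j) *\<^sub>R W + b (Suc j) *\<^sub>R (A ** W) + c (Suc j) *\<^sub>R ((A ** A) ** W)) *v r
      = (a (Suc j) * t + b (Suc j) * t ^ 3 + c (Suc j) * t ^ 5) *\<^sub>R v"
    by (simp add: matrix_vector_mult_add_rdistrib scaleR_matrix_vector_assoc[symmetric]
        matrix_vector_mult_scaleR IH Av flip: matrix_vector_mul_assoc)
       (simp add: algebra_simps power2_eq_square eval_nat_numeral)
  ultimately show ?case by (simp add: Let_def W_def A_def t_def)
qed (use assms in simp)

lemma ns_scalar_zero [simp]: "ns_scalar a b c j 0 = 0"
  by (induction j) (simp_all add: Let_def)

text \<open>For every \<open>v\<close> of an eigenbasis of \<open>Z ** transpose Z\<close>, the map
  multiplies \<open>v v* Z\<close> by some \<open>p\<close> between \<open>\<l>\<close> and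
  \<open>u\<close>. Both claims are then termwise comparisons of Parseval sums, so no rank
  enters.\<close>

lemma ns_iter_bounds:
  fixes Z :: "real ^ 'm::finite ^ 'n::finite"
  assumes Z: "norm Z \<le> 1"
    and lo: "\<And>s. 0 < s \<Longrightarrow> s \<le> 1 \<Longrightarrow> \<l> * s \<le> ns_scalar a b c J s"
    and hi: "\<And>s. 0 < s \<Longrightarrow> s \<le> 1 \<Longrightarrow> ns_scalar a b c J s \<le> u * s"
    and pos: "0 \<le> \<l>" "0 \<le> u"
  shows "\<l> * (norm Z)\<^sup>2 \<le> Z \<bullet> ns_iter a b c J Z"
    and "norm (ns_iter a b c J Z) \<le> u * norm Z"
proof -
  \<comment> \<open>An orthonormal eigenbasis of \<open>Z Z\<^sup>T\<close> replaces the singular value decomposition.\<close>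
  define A where "A = (\<lambda>v. Z *v (v v* Z))"
  have lin: "linear A"
    unfolding A_def
    by (rule linearI) (simp_all add: vector_matrix_left_distrib matrix_vector_right_distrib
        scaleR_vector_matrix_assoc matrix_vector_mult_scaleR)
  have sym: "A x \<bullet> y = x \<bullet> A y" for x y
    unfolding A_def by (metis dot_lmul_matrix inner_commute)
  obtain B e where B: "finite B" "pairwise orthogonal B"
    "\<And>v. v \<in> B \<Longrightarrow> norm v = 1" "span B = UNIV" and eig: "\<And>v. v \<in> B \<Longrightarrow> A v = e v *\<^sub>R v"
    using selfadjoint_orthonormal_eigenbasis[OF lin sym] by metis
  define Y where "Y = ns_iter a b c J Z"
  note parseval = matrix_inner_orthonormal_basis[OF B]
  have eqs: "\<exists>p. \<l> \<le> p \<and> p \<le> u \<and> v v* Y = p *\<^sub>R (v v* Z)" if v: "v \<in> B" and nz: "v v* Z \<noteq> 0" for v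
  proof -
    define s where "s = norm (v v* Z)"
    define r where "r = (1 / s) *\<^sub>R (v v* Z)"
    have s: "s > 0" using nz by (simp add: s_def)
    \<comment> \<open>The squared singular values sum to the squared Frobenius norm. Frobenius
      normalization therefore brings each of them into the range \<open>0 < s \<le> 1\<close> where
      \<open>lo\<close> and \<open>hi\<close> apply.\<close>
    have "s\<^sup>2 \<le> (\<Sum>v\<in>B. (v v* Z) \<bullet> (v v* Z))"
      using B(1) v by (auto simp: s_def power2_norm_eq_inner intro!: member_le_sum)
    also have "\<dots> = (norm Z)\<^sup>2" by (simp add: parseval power2_norm_eq_inner)
    also have "\<dots> \<le> 1\<^sup>2" using Z by (intro power_mono) auto
    finally have s1: "s \<le> 1" by (rule power2_le_imp_le) simp
    \<comment> \<open>Identifying the eigenvalue with the squared singular value turns the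
      eigenvector equation into the second half of a singular pair.\<close>
    have "e v = v \<bullet> A v"
      using B(3)[OF v] by (simp add: eig[OF v] norm_eq_1)
    also have "\<dots> = s\<^sup>2"
      by (simp add: A_def s_def power2_norm_eq_inner flip: dot_lmul_matrix)
    finally have "Z *v r = s *\<^sub>R v"
      using eig[OF v] s by (simp add: A_def r_def matrix_vector_mult_scaleR power2_eq_square)
    moreover have "v v* Z = s *\<^sub>R r" using s by (simp add: r_def)
    ultimately have "v v* Y = ns_scalar a b c J s *\<^sub>R r"
      unfolding Y_def using ns_iter_singular_pair by blast
    then have "v v* Y = (ns_scalar a b c J s / s) *\<^sub>R (v v* Z)" by (simp add: r_def)
    moreover have "\<l> \<le> ns_scalar a b c J s / s" "ns_scalar a b c J s / s \<le> u"
      using lo[OF s s1] hi[OF s s1] s by (auto simp: field_simps)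
    ultimately show ?thesis by blast
  qed
  \<comment> \<open>The degenerate pair with \<open>s = 0\<close> and \<open>r = 0\<close> covers
    these directions, where no quotient by \<open>s\<close> is available.\<close>
  have zero: "v v* Y = 0" if "v v* Z = 0" for v
    using ns_iter_singular_pair[of v Z 0 0 a b c J] that by (simp add: Y_def)
  have "\<l> * (norm Z)\<^sup>2 = (\<Sum>v\<in>B. \<l> * ((v v* Z) \<bullet> (v v* Z)))"
    by (simp add: power2_norm_eq_inner parseval sum_distrib_left)
  also have "\<dots> \<le> (\<Sum>v\<in>B. (v v* Z) \<bullet> (v v* Y))"
  proof (rule sum_mono)
    fix v assume "v \<in> B"
    then show "\<l> * ((v v* Z) \<bullet> (v v* Z)) \<le> (v v* Z) \<bullet> (v v* Y)"
      using eqs[of v] zero[of v] by (cases "v v* Z = 0") (auto intro: mult_right_mono)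
  qed
  finally show "\<l> * (norm Z)\<^sup>2 \<le> Z \<bullet> ns_iter a b c J Z"
    by (simp add: parseval Y_def)
  have "(norm Y)\<^sup>2 = (\<Sum>v\<in>B. (v v* Y) \<bullet> (v v* Y))"
    by (simp add: power2_norm_eq_inner parseval)
  also have "\<dots> \<le> (\<Sum>v\<in>B. u\<^sup>2 * ((v v* Z) \<bullet> (v v* Z)))"
  proof (rule sum_mono)
    fix v assume v: "v \<in> B"
    show "(v v* Y) \<bullet> (v v* Y) \<le> u\<^sup>2 * ((v v* Z) \<bullet> (v v* Z))"
    proof (cases "v v* Z = 0")
      case False
      then obtain p where p: "\<l> \<le> p" "p \<le> u" "v v* Y = p *\<^sub>R (v v* Z)" using eqs v by blast
      then have "p\<^sup>2 \<le> u\<^sup>2" using pos by (intro power_mono) auto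
      then have "p\<^sup>2 * ((v v* Z) \<bullet> (v v* Z)) \<le> u\<^sup>2 * ((v v* Z) \<bullet> (v v* Z))"
        by (intro mult_right_mono) auto
      moreover have "(v v* Y) \<bullet> (v v* Y) = p\<^sup>2 * ((v v* Z) \<bullet> (v v* Z))"
        by (simp add: p power2_eq_square)
      ultimately show ?thesis by simp
    qed (simp add: zero)
  qed
  also have "\<dots> = (u * norm Z)\<^sup>2"
    by (simp add: power2_norm_eq_inner parseval power_mult_distrib sum_distrib_left)
  finally show "norm (ns_iter a b c J Z) \<le> u * norm Z"
    unfolding Y_def[symmetric] by (rule power2_le_imp_le) (use pos in simp)
qed

text \<open>The normalized matrix has norm exactly \<open>1\<close>, and the inner product scales
  back linearly with \<open>norm N\<close>. At \<open>N = 0\<close> the output \<open>0\<close>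
  satisfies both bounds.\<close>

lemma newton_schulz_bounds:
  fixes N :: "real ^ 'm::finite ^ 'n::finite"
  assumes lo: "\<And>s. 0 < s \<Longrightarrow> s \<le> 1 \<Longrightarrow> \<l> * s \<le> ns_scalar a b c J s"
    and hi: "\<And>s. 0 < s \<Longrightarrow> s \<le> 1 \<Longrightarrow> ns_scalar a b c J s \<le> u * s"
    and pos: "0 \<le> \<l>" "0 \<le> u"
  shows "\<l> * norm N \<le> N \<bullet> newton_schulz a b c J N"
    and "norm (newton_schulz a b c J N) \<le> u"
proof -
  have "\<l> * norm N \<le> N \<bullet> newton_schulz a b c J N \<and> norm (newton_schulz a b c J N) \<le> u"
  proof (cases "N = 0")
    case False
    define Z where "Z = (1 / norm N) *\<^sub>R N"
    have Z: "norm Z = 1" "N = norm N *\<^sub>R Z" using False by (auto simp: Z_def)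
    have "\<l> \<le> Z \<bullet> ns_iter a b c J Z" "norm (ns_iter a b c J Z) \<le> u"
      using ns_iter_bounds[of Z \<l> a b c J u] assms Z(1) by auto
    moreover have "N \<bullet> ns_iter a b c J Z = norm N * (Z \<bullet> ns_iter a b c J Z)"
      using Z(2) by (metis inner_scaleR_left)
    ultimately show ?thesis
      using False by (simp add: newton_schulz_def Z_def[symmetric] mult.commute mult_left_mono)
  qed (use pos in \<open>simp add: newton_schulz_def\<close>)
  then show "\<l> * norm N \<le> N \<bullet> newton_schulz a b c J N" "norm (newton_schulz a b c J N) \<le> u"
    by auto
qed

text \<open>Zero padding survives the orthogonalization, so the iterates stay in the parameter
  space.\<close>

lemma newton_schulz_support:
  fixes N :: "real ^ 'm::finite ^ 'n::finite"
  assumes "\<And>i j. i \<notin> R \<or> j \<notin> C \<Longrightarrow> N $ i $ j = 0" and "i \<notin> R \<or> j \<notin> C"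
  shows "newton_schulz a b c J N $ i $ j = 0"
proof -
  have "ns_iter a b c k Z $ i $ j = 0"
    if "\<And>i j. i \<notin> R \<or> j \<notin> C \<Longrightarrow> Z $ i $ j = 0" "i \<notin> R \<or> j \<notin> C"
    for k i j and Z :: "real ^ 'm ^ 'n"
    using that(2)
  proof (induction k arbitrary: i j)
    case (Suc k)
    define W where "W = ns_iter a b c k Z"
    have W: "W $ i $ j = 0" if "i \<notin> R \<or> j \<notin> C" for i j
      using Suc.IH that by (simp add: W_def)
    have left: "(A ** W) $ i $ j = 0" if "j \<notin> C" for A :: "real ^ 'n ^ 'n" and i j
      using that by (simp add: matrix_matrix_mult_def W)
    have right: "(W ** U) $ i $ k = 0" if "i \<notin> R" for U :: "real ^ 'k ^ 'm" and i k
      using that by (simp add: matrix_matrix_mult_def W)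
    \<comment> \<open>Both products begin and end with a factor \<open>W\<close>. The left factor
      kills the rows outside \<open>R\<close>, the right one the columns outside
      \<open>C\<close>.\<close>
    have "((W ** transpose W) ** W) $ i $ j = 0 \<and>
      ((W ** transpose W) ** (W ** transpose W) ** W) $ i $ j = 0"
    proof (cases "j \<in> C")
      case True
      then have "i \<notin> R" using Suc.prems by blast
      then show ?thesis by (simp only: right simp_thms flip: matrix_mul_assoc)
    next
      case False
      then show ?thesis by (simp only: left simp_thms)
    qed
    with W[OF Suc.prems] show ?case by (simp add: Let_def W_def[symmetric])
  qed (use that in auto)
  then show ?thesis using assms by (auto simp: newton_schulz_def)
qed

section \<open>Continuity and measurability of the Newton--Schulz map\<close>

lemma continuous_on_matrix_mult:
  fixes f :: "'a::topological_space \<Rightarrow> real ^ 'm::finite ^ 'n::finite" and g :: "'a \<Rightarrow> real ^ 'k::finite ^ 'm"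
  assumes "continuous_on S f" "continuous_on S g"
  shows "continuous_on S (\<lambda>x. f x ** g x)"
  unfolding matrix_matrix_mult_def
  by (intro continuous_on_vec_lambda continuous_on_sum continuous_on_mult continuous_on_component assms)

lemma continuous_on_ns_iter:
  "continuous_on UNIV (ns_iter a b c j :: real ^ 'm::finite ^ 'n::finite \<Rightarrow> _)"
proof (induction j)
  case (Suc j)
  then show ?case
    unfolding ns_iter.simps Let_def
    unfolding transpose_def
    by (intro continuous_on_add continuous_on_scaleR continuous_on_const continuous_on_matrix_mult
        continuous_on_vec_lambda continuous_on_component)
qed simp

text \<open>The normalization need not extend continuously to \<open>0\<close>, but the case
  distinction at that one point is Borel.\<close>

lemma borel_measurable_newton_schulz [measurable]:
  "newton_schulz a b c J \<in> borel_measurable (borel :: (real ^ 'm::finite ^ 'n::finite) measure)"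
proof -
  have [measurable]: "ns_iter a b c J \<in> borel_measurable (borel :: (real ^ 'm ^ 'n) measure)"
    by (rule borel_measurable_continuous_onI[OF continuous_on_ns_iter])
  show ?thesis unfolding newton_schulz_def[abs_def] by measurable
qed

subsection \<open>Descent along a single trajectory\<close>

text \<open>Weighted AM-GM for \<open>1\<close> and \<open>x\<close>. It makes the smoothness
  constant affine in the gradient norm: the constant part gives \<open>L0 + (1 - q) * L1\<close>,
  and the linear part is later absorbed into the descent term.\<close>

lemma grad_power_le:
  assumes "0 \<le> x" "0 \<le> q" "q \<le> 1"
  shows "grad_power x q \<le> 1 - q + q * x"
proof (cases "x = 0 \<or> q = 0")
  case False
  then have "x > 0" using assms by simp
  then show ?thesis
    using False Youngs_inequality_0[of "1 - q" q 1 x] assms by (simp add: grad_power_def)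
qed (use assms in \<open>auto simp: grad_power_def\<close>)

lemma grad_power_nonneg: "0 \<le> grad_power x q"
  by (simp add: grad_power_def)

text \<open>The line stays in \<open>S\<close>, so the derivative relative to \<open>S\<close>
  composes to an ordinary derivative in one real variable.\<close>

lemma gradient_on_line_derivative:
  fixes S :: "'a::euclidean_space set"
  assumes S: "subspace S" and XS: "X + s *\<^sub>R H \<in> S" and HS: "H \<in> S"
    and h: "h differentiable (at (X + s *\<^sub>R H) within S)"
  shows "((\<lambda>s. h (X + s *\<^sub>R H)) has_real_derivative gradient_on S h (X + s *\<^sub>R H) \<bullet> H) (at s)"
proof -
  have line: "((\<lambda>s. X + s *\<^sub>R H) has_derivative (\<lambda>t. t *\<^sub>R H)) (at s)"
    by (auto intro!: derivative_eq_intros)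
  have "X + t *\<^sub>R H \<in> S" for t
    using subspace_add[OF S XS subspace_scale[OF S HS, of "t - s"]] by (simp add: algebra_simps)
  then have sub: "range (\<lambda>s. X + s *\<^sub>R H) \<subseteq> S" by auto
  have "((\<lambda>s. h (X + s *\<^sub>R H)) has_derivative
      (\<lambda>t. gradient_on S h (X + s *\<^sub>R H) \<bullet> (t *\<^sub>R H))) (at s)"
    by (rule has_derivative_in_compose[OF line has_derivative_subset[OF gradient_on_works(2)[OF S XS h] sub]])
  then show ?thesis
    by (simp add: has_field_derivative_def mult_commute_abs)
qed

lemma joint_smooth_descent:
  fixes S :: "'a::euclidean_space set"
  assumes S: "subspace S" and smooth: "joint_smooth S F L0 L1 q" and X: "X \<in> S" and Y: "Y \<in> S"
  defines "g \<equiv> gradient_on S F X"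
  shows "F Y \<le> F X + g \<bullet> (Y - X) + (L0 + L1 * grad_power (norm g) q) / 2 * (norm (Y - X))\<^sup>2"
proof -
  define H where "H = Y - X"
  define K where "K = L0 + L1 * grad_power (norm g) q"
  define \<psi> where "\<psi> s = F (X + s *\<^sub>R H) - s * (g \<bullet> H) - K / 2 * s\<^sup>2 * (norm H)\<^sup>2" for s
  define \<psi>' where "\<psi>' s = gradient_on S F (X + s *\<^sub>R H) \<bullet> H - g \<bullet> H - K * s * (norm H)\<^sup>2" for s
  have HS: "X + s *\<^sub>R H \<in> S" for s
    using S X Y by (auto simp: H_def intro!: subspace_add subspace_scale subspace_diff)
  have HS0: "H \<in> S" using S X Y by (auto simp: H_def intro: subspace_diff)
  have deriv: "(\<psi> has_real_derivative \<psi>' s) (at s)" for s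
  proof -
    have "F differentiable (at (X + s *\<^sub>R H) within S)"
      using smooth HS by (auto simp: joint_smooth_def)
    note [derivative_intros] = gradient_on_line_derivative[OF S HS HS0 this]
    show ?thesis
      unfolding \<psi>_def[abs_def] \<psi>'_def
      by (rule derivative_eq_intros refl | simp)+
  qed
  have nonpos: "\<psi>' s \<le> 0" if "0 \<le> s" for s
  proof -
    have "norm (g - gradient_on S F (X + s *\<^sub>R H)) \<le> K * norm (X - (X + s *\<^sub>R H))"
      using smooth X HS[of s] unfolding joint_smooth_def g_def K_def by blast
    then have "norm (gradient_on S F (X + s *\<^sub>R H) - g) \<le> K * (s * norm H)"
      using that by (simp add: norm_minus_commute)
    then have "norm (gradient_on S F (X + s *\<^sub>R H) - g) * norm H \<le> K * (s * norm H) * norm H"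
      by (rule mult_right_mono) simp
    moreover have "(gradient_on S F (X + s *\<^sub>R H) - g) \<bullet> H
        \<le> norm (gradient_on S F (X + s *\<^sub>R H) - g) * norm H"
      by (rule norm_cauchy_schwarz)
    ultimately show ?thesis
      by (simp add: \<psi>'_def inner_diff_left power2_eq_square mult.assoc)
  qed
  have "\<psi> 1 \<le> \<psi> 0"
    by (rule DERIV_nonpos_imp_nonincreasing[of 0 1]) (use deriv nonpos in auto)
  then show ?thesis
    by (simp add: \<psi>_def H_def K_def)
qed

section \<open>Block norms against the norm of the whole parameter\<close>

lemma norm_le_sum_norm_nth: "norm x \<le> (\<Sum>l\<in>UNIV. norm (x $ l))"
  unfolding norm_vec_def by (rule L2_set_le_sum) simp

text \<open>Cauchy--Schwarz against the constant vector \<open>1\<close>. In the gradient drift this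
  square root meets the one from \<open>norm_le_of_norm_nth_le\<close>, and together they give the
  number of layers.\<close>

lemma sum_norm_nth_le_norm:
  fixes x :: "'a::real_normed_vector ^ 'l::finite"
  shows "(\<Sum>l\<in>UNIV. norm (x $ l)) \<le> sqrt (real CARD('l)) * norm x"
  using L2_set_mult_ineq[of "\<lambda>_. 1" "\<lambda>l. norm (x $ l)" "UNIV :: 'l set"]
  by (simp add: norm_vec_def L2_set_def)

lemma norm_le_of_norm_nth_le:
  fixes x :: "'a::real_normed_vector ^ 'l::finite"
  assumes "\<And>l. norm (x $ l) \<le> c"
  shows "norm x \<le> sqrt (real CARD('l)) * c"
proof -
  have "0 \<le> c" using assms[of undefined] norm_ge_zero order_trans by blast
  have "norm x \<le> L2_set (\<lambda>_::'l. c) UNIV"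
    unfolding norm_vec_def by (rule L2_set_mono) (use assms in auto)
  then show ?thesis using \<open>0 \<le> c\<close> by (simp add: L2_set_def real_sqrt_mult)
qed

text \<open>Write \<open>g \<bullet> o'\<close> as
  \<open>n \<bullet> o' - (n - g) \<bullet> o'\<close>. The error \<open>n - g\<close> costs
  \<open>u\<close> by Cauchy--Schwarz and \<open>\<l>\<close> when \<open>norm n\<close> is replaced
  by \<open>norm g\<close>.\<close>

lemma descent_direction_inner:
  fixes g n o' :: "'a::real_inner"
  assumes "\<l> * norm n \<le> n \<bullet> o'" "norm o' \<le> u" "0 \<le> \<l>"
  shows "\<l> * norm g - (\<l> + u) * norm (n - g) \<le> g \<bullet> o'"
proof -
  have "(n - g) \<bullet> o' \<le> norm (n - g) * norm o'" by (rule norm_cauchy_schwarz)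
  also have "\<dots> \<le> norm (n - g) * u" by (rule mult_left_mono) (use assms in auto)
  finally have "n \<bullet> o' - g \<bullet> o' \<le> norm (n - g) * u" by (simp add: inner_diff_left)
  moreover have "\<l> * norm g \<le> \<l> * (norm n + norm (n - g))"
    using assms(3) norm_triangle_sub[of g n] by (intro mult_left_mono) (simp_all add: norm_minus_commute)
  ultimately show ?thesis using assms(1) by (simp add: algebra_simps)
qed

text \<open>This is the deterministic part of the argument: \<open>V\<close> enters only through its
  recursion, and the noise norms are left for a later estimate. Drift and quadratic terms contain
  gradient norms again; moving those to the left gives the reduced coefficient.\<close>

lemma muon_path_bound:
  fixes X G M N Q V :: "nat \<Rightarrow> real ^ 'm::finite ^ 'n::finite ^ 'l::finite"
    and S :: "(real ^ 'm ^ 'n ^ 'l) set"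
    and F :: "real ^ 'm ^ 'n ^ 'l \<Rightarrow> real"
    and \<gamma> \<beta>1 \<beta>2 :: real
  defines "g \<equiv> \<lambda>t. gradient_on S F (X t)" and "L \<equiv> real CARD('l)"
  assumes S: "subspace S" and smooth: "joint_smooth S F L0 L1 q"
    and lower: "\<And>Y. Y \<in> S \<Longrightarrow> Fstar \<le> F Y"
    and XS: "\<And>t. t \<in> {1..T+1} \<Longrightarrow> X t \<in> S"
    and T: "1 \<le> T" and \<gamma>: "0 < \<gamma>" and \<beta>1: "0 \<le> \<beta>1" "\<beta>1 < 1" and \<beta>2: "0 \<le> \<beta>2" "\<beta>2 \<le> 1"
    and pos: "0 \<le> \<l>" "0 \<le> u"
    and orth: "\<And>t l. t \<in> {1..T} \<Longrightarrow> \<l> * norm (N t $ l) \<le> N t $ l \<bullet> Q t $ l"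
      "\<And>t l. t \<in> {1..T} \<Longrightarrow> norm (Q t $ l) \<le> u"
    and M0: "M 0 = 0"
    and M: "\<And>t. t \<in> {1..T} \<Longrightarrow> M t = \<beta>1 *\<^sub>R M (t - 1) + (1 - \<beta>1) *\<^sub>R G t"
    and N: "\<And>t. t \<in> {1..T} \<Longrightarrow> N t = \<beta>2 *\<^sub>R M t + (1 - \<beta>2) *\<^sub>R G t"
    and X: "\<And>t. t \<in> {1..T} \<Longrightarrow> X (t + 1) = X t - \<gamma> *\<^sub>R Q t"
    and V0: "V 0 = 0"
    and V: "\<And>t. t \<in> {1..T} \<Longrightarrow> V t = \<beta>1 *\<^sub>R V (t - 1) + (1 - \<beta>1) *\<^sub>R (G t - g t)"
  shows "(\<l> - \<gamma> * L * u\<^sup>2 * q * L1 / 2 - \<gamma> * L * u * (\<l> + u) * q * L1 / (1 - \<beta>1))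
        * (\<Sum>t=1..T. \<Sum>l\<in>UNIV. norm (g t $ l))
    \<le> (F (X 1) - Fstar) / \<gamma> + (\<l> + u) * (\<Sum>l\<in>UNIV. norm (g 1 $ l)) / (1 - \<beta>1)
      + real T * (\<gamma> * L * u * (\<l> + u) * (L0 + (1 - q) * L1) / (1 - \<beta>1)
                  + \<gamma> * L * u\<^sup>2 * (L0 + (1 - q) * L1) / 2)
      + (\<l> + u) * (\<Sum>t=1..T. \<Sum>l\<in>UNIV. norm (V t $ l) + (1 - \<beta>2) * norm ((G t - g t) $ l))"
proof -
  define h where "h t = (\<Sum>l\<in>UNIV. norm (g t $ l))" for t
  define Lhat where "Lhat = L0 + (1 - q) * L1"
  define K where "K t = Lhat + q * L1 * h t" for t
  \<comment> \<open>\<open>V\<close> is the part of the momentum error that comes from the noise, \<open>R\<close> the deterministic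
    remainder, which starts as if \<open>R 0 = - g 1\<close> with no drift in the first step.\<close>
  define R where "R t = M t - g t - V t" for t
  define r where "r t = (\<Sum>l\<in>UNIV. norm (R t $ l))" for t
  define e where "e t = (\<Sum>l\<in>UNIV. norm (V t $ l) + (1 - \<beta>2) * norm ((G t - g t) $ l))" for t
  have params: "0 < L0" "0 \<le> L1" "0 \<le> q" "q \<le> 1"
    using smooth by (auto simp: joint_smooth_def)
  have L: "0 \<le> L" by (simp add: L_def)
  have h: "0 \<le> h t" "norm (g t) \<le> h t" for t
    using norm_le_sum_norm_nth[of "g t"] by (auto simp: h_def sum_nonneg)
  have K: "L0 + L1 * grad_power (norm (g t)) q \<le> K t" for t
  proof -
    have "L1 * grad_power (norm (g t)) q \<le> L1 * (1 - q + q * norm (g t))"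
      using grad_power_le params by (intro mult_left_mono) auto
    also have "\<dots> \<le> L1 * (1 - q + q * h t)"
      using h params by (intro mult_left_mono add_left_mono) auto
    finally show ?thesis by (simp add: K_def Lhat_def algebra_simps)
  qed
  have K0: "0 \<le> K t" for t
    using params h by (auto simp: K_def Lhat_def intro!: add_nonneg_nonneg mult_nonneg_nonneg)
  have step: "norm (X (t + 1) - X t) \<le> sqrt L * (\<gamma> * u)" if "t \<in> {1..T}" for t
    unfolding L_def
  proof (rule norm_le_of_norm_nth_le)
    fix l
    have "norm ((X (t + 1) - X t) $ l) = \<gamma> * norm (Q t $ l)"
      unfolding X[OF that] using \<gamma> by simp
    then show "norm ((X (t + 1) - X t) $ l) \<le> \<gamma> * u"
      using orth(2)[OF that, of l] \<gamma> by (simp add: mult_left_mono)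
  qed

  have desc: "F (X (t + 1)) \<le> F (X t) - \<gamma> * \<l> * h t + \<gamma> * (\<l> + u) * (r t + e t)
      + \<gamma>\<^sup>2 * L * u\<^sup>2 / 2 * K t" if t: "t \<in> {1..T}" for t
  proof -
    have mem: "X t \<in> S" "X (t + 1) \<in> S" using XS t by auto
    have "(norm (X (t + 1) - X t))\<^sup>2 \<le> (sqrt L * (\<gamma> * u))\<^sup>2"
      using step[OF t] by (rule power_mono) simp
    also have "\<dots> = \<gamma>\<^sup>2 * L * u\<^sup>2" using L by (simp add: power_mult_distrib)
    finally have "(L0 + L1 * grad_power (norm (g t)) q) / 2 * (norm (X (t + 1) - X t))\<^sup>2
        \<le> K t / 2 * (\<gamma>\<^sup>2 * L * u\<^sup>2)"
      using K[of t] K0[of t] by (intro mult_mono) auto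
    with joint_smooth_descent[OF S smooth mem]
    have 1: "F (X (t + 1)) \<le> F (X t) + g t \<bullet> (X (t + 1) - X t) + K t / 2 * (\<gamma>\<^sup>2 * L * u\<^sup>2)"
      by (simp add: g_def)
    have "\<l> * h t - (\<l> + u) * (\<Sum>l\<in>UNIV. norm (N t $ l - g t $ l))
        = (\<Sum>l\<in>UNIV. \<l> * norm (g t $ l) - (\<l> + u) * norm (N t $ l - g t $ l))"
      by (simp add: h_def sum_subtractf sum_distrib_left)
    also have "\<dots> \<le> (\<Sum>l\<in>UNIV. g t $ l \<bullet> Q t $ l)"
      by (intro sum_mono descent_direction_inner orth t pos)
    finally have 2: "\<l> * h t - (\<l> + u) * (\<Sum>l\<in>UNIV. norm (N t $ l - g t $ l)) \<le> g t \<bullet> Q t"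
      by (simp add: inner_vec_def)
    \<comment> \<open>Since \<open>M t - g t = R t + V t\<close>, the error of \<open>N t\<close> is
      a convex combination of \<open>R t + V t\<close> and the fresh noise. The weight
      \<open>\<beta>2\<close> of the first part is bounded by \<open>1\<close>.\<close>
    have "(\<Sum>l\<in>UNIV. norm (N t $ l - g t $ l)) \<le> (\<Sum>l\<in>UNIV. norm (R t $ l) +
        (norm (V t $ l) + (1 - \<beta>2) * norm ((G t - g t) $ l)))"
    proof (rule sum_mono)
      fix l
      have "N t $ l - g t $ l = \<beta>2 *\<^sub>R (R t $ l + V t $ l) + (1 - \<beta>2) *\<^sub>R ((G t - g t) $ l)"
        by (simp add: N[OF t] R_def algebra_simps)
      also have "norm \<dots> \<le> norm (\<beta>2 *\<^sub>R (R t $ l + V t $ l)) + norm ((1 - \<beta>2) *\<^sub>R ((G t - g t) $ l))"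
        by (rule norm_triangle_ineq)
      also have "\<dots> = \<beta>2 * norm (R t $ l + V t $ l) + (1 - \<beta>2) * norm ((G t - g t) $ l)"
        using \<beta>2 by simp
      also have "\<dots> \<le> 1 * (norm (R t $ l) + norm (V t $ l)) + (1 - \<beta>2) * norm ((G t - g t) $ l)"
        using \<beta>2 by (intro add_right_mono mult_mono norm_triangle_ineq) auto
      finally show "norm (N t $ l - g t $ l) \<le> norm (R t $ l) +
        (norm (V t $ l) + (1 - \<beta>2) * norm ((G t - g t) $ l))" by simp
    qed
    then have "(\<Sum>l\<in>UNIV. norm (N t $ l - g t $ l)) \<le> r t + e t"
      by (simp add: r_def e_def sum.distrib)
    then have "(\<l> + u) * (\<Sum>l\<in>UNIV. norm (N t $ l - g t $ l)) \<le> (\<l> + u) * (r t + e t)"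
      using pos by (intro mult_left_mono) auto
    with 2 have "\<gamma> * (\<l> * h t - (\<l> + u) * (r t + e t)) \<le> \<gamma> * (g t \<bullet> Q t)"
      using \<gamma> by (intro mult_left_mono) auto
    moreover have "X (t + 1) - X t = - (\<gamma> *\<^sub>R Q t)" using X[OF t] by simp
    then have "g t \<bullet> (X (t + 1) - X t) = - (\<gamma> * (g t \<bullet> Q t))" by simp
    ultimately show ?thesis using 1 by (simp add: algebra_simps)
  qed

  have tele: "F (X (n + 1)) \<le> F (X 1) - \<gamma> * \<l> * (\<Sum>t=1..n. h t)
      + \<gamma> * (\<l> + u) * ((\<Sum>t=1..n. r t) + (\<Sum>t=1..n. e t))
      + \<gamma>\<^sup>2 * L * u\<^sup>2 / 2 * (\<Sum>t=1..n. K t)" if "n \<le> T" for n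
    using that
  proof (induction n)
    case (Suc n)
    then show ?case using desc[of "Suc n"] by (simp add: algebra_simps add_divide_distrib)
  qed simp

  \<comment> \<open>One factor \<open>sqrt L\<close> comes from the step length and one from passing
    to the sum of block norms.\<close>
  have drift: "(\<Sum>l\<in>UNIV. norm (g t $ l - g (Suc t) $ l)) \<le> \<gamma> * L * u * K t" if t: "t \<in> {1..T}" for t
  proof -
    have "norm (g t - g (t + 1)) \<le> (L0 + L1 * grad_power (norm (g t)) q) * norm (X t - X (t + 1))"
      using smooth XS[of t] XS[of "t + 1"] t by (auto simp: joint_smooth_def g_def)
    also have "\<dots> \<le> K t * (sqrt L * (\<gamma> * u))"
      using K[of t] K0[of t] step[OF t] by (intro mult_mono) (auto simp: norm_minus_commute)
    finally have "sqrt L * norm (g t - g (t + 1)) \<le> sqrt L * (K t * (sqrt L * (\<gamma> * u)))"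
      using L by (intro mult_left_mono) auto
    also have "\<dots> = (sqrt L * sqrt L) * (\<gamma> * u * K t)" by (simp only: ac_simps)
    also have "sqrt L * sqrt L = L" using L by simp
    finally show ?thesis
      using sum_norm_nth_le_norm[of "g t - g (t + 1)"] by (simp add: L_def ac_simps)
  qed

  \<comment> \<open>With \<open>M 0 = 0\<close> and \<open>V 0 = 0\<close>, the bias after the first
    step is exactly \<open>- \<beta>1\<close> times the first gradient.\<close>
  have r_first: "r 1 \<le> \<beta>1 * h 1"
  proof -
    have "R 1 = - (\<beta>1 *\<^sub>R g 1)"
    proof -
      have "M 1 = (1 - \<beta>1) *\<^sub>R G 1" "V 1 = (1 - \<beta>1) *\<^sub>R (G 1 - g 1)"
        using M[of 1] V[of 1] T by (simp_all add: M0 V0)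
      then show ?thesis by (simp only: R_def) (simp add: algebra_simps)
    qed
    then show ?thesis using \<beta>1 by (simp add: r_def h_def sum_distrib_left)
  qed
  have r_step: "r (Suc t) \<le> \<beta>1 * (r t + \<gamma> * L * u * K t)" if t: "1 \<le> t" "Suc t \<le> T" for t
  proof -
    \<comment> \<open>In \<open>M - V\<close> the stochastic gradients cancel, so the remainder is
      driven by the gradient increments alone.\<close>
    have eq: "R (Suc t) = \<beta>1 *\<^sub>R (R t + (g t - g (Suc t)))"
    proof -
      have "M (Suc t) = \<beta>1 *\<^sub>R M t + (1 - \<beta>1) *\<^sub>R G (Suc t)"
        "V (Suc t) = \<beta>1 *\<^sub>R V t + (1 - \<beta>1) *\<^sub>R (G (Suc t) - g (Suc t))"
        using M[of "Suc t"] V[of "Suc t"] t by simp_all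
      then show ?thesis by (simp only: R_def) (simp add: algebra_simps)
    qed
    have "r (Suc t) \<le> (\<Sum>l\<in>UNIV. \<beta>1 * (norm (R t $ l) + norm (g t $ l - g (Suc t) $ l)))"
      unfolding r_def eq
      by (rule sum_mono) (use \<beta>1 mult_left_mono[OF norm_triangle_ineq \<beta>1(1)] in simp)
    also have "\<dots> = \<beta>1 * (r t + (\<Sum>l\<in>UNIV. norm (g t $ l - g (Suc t) $ l)))"
      by (simp add: r_def sum.distrib flip: sum_distrib_left)
    also have "\<dots> \<le> \<beta>1 * (r t + \<gamma> * L * u * K t)"
      using drift[of t] t \<beta>1 by (intro mult_left_mono) auto
    finally show ?thesis .
  qed
  have r0: "0 \<le> r t" for t by (simp add: r_def sum_nonneg)
  \<comment> \<open>Telescopes \<open>r (t + 1) - \<beta>1 * r t\<close>.\<close>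
  have potential: "(1 - \<beta>1) * (\<Sum>t=1..Suc n. r t) + \<beta>1 * r (Suc n)
      \<le> \<beta>1 * (h 1 + \<gamma> * L * u * (\<Sum>t=1..n. K t))" if "Suc n \<le> T" for n
    using that
  proof (induction n)
    case 0
    then show ?case using r_first by (simp add: algebra_simps)
  next
    case (Suc n)
    then show ?case using r_step[of "Suc n"] by (simp add: algebra_simps)
  qed
  define Ks where "Ks = (\<Sum>t=1..T. K t)"
  define Rs where "Rs = (\<Sum>t=1..T. r t)"
  define Es where "Es = (\<Sum>t=1..T. e t)"
  define Hs where "Hs = (\<Sum>t=1..T. h t)"
  obtain n where n: "T = Suc n" using T by (cases T) auto
  \<comment> \<open>The nonnegative \<open>\<beta>1 * r T\<close> is dropped; then
    \<open>\<beta>1\<close> is replaced by \<open>1\<close>, and the sum of \<open>K\<close>, which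
    ends at \<open>T - 1\<close>, is extended to \<open>T\<close>.\<close>
  have "(1 - \<beta>1) * Rs \<le> (1 - \<beta>1) * Rs + \<beta>1 * r T" using \<beta>1 r0 by simp
  also have "\<dots> \<le> \<beta>1 * (h 1 + \<gamma> * L * u * (\<Sum>t=1..n. K t))"
    using potential[of n] n by (simp add: Rs_def)
  also have "\<dots> \<le> 1 * (h 1 + \<gamma> * L * u * Ks)"
    unfolding Ks_def n using \<beta>1 K0 h L \<gamma> pos
    by (intro mult_mono add_left_mono mult_left_mono add_nonneg_nonneg mult_nonneg_nonneg sum_nonneg) auto
  finally have Rs: "Rs \<le> (h 1 + \<gamma> * L * u * Ks) / (1 - \<beta>1)"
    using \<beta>1 by (simp add: pos_le_divide_eq mult.commute)
  \<comment> \<open>The summand with \<open>Hs\<close> is the one that moves to the left of the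
    final inequality.\<close>
  have Ks: "Ks = real T * Lhat + q * L1 * Hs"
    by (simp add: Ks_def K_def Hs_def sum.distrib sum_distrib_left)
  \<comment> \<open>The telescoped sum ends at \<open>X (T + 1)\<close>, and this is the iterate to
    which the lower bound of \<open>F\<close> is applied.\<close>
  have "Fstar \<le> F (X 1) - \<gamma> * \<l> * Hs + \<gamma> * (\<l> + u) * (Rs + Es) + \<gamma>\<^sup>2 * L * u\<^sup>2 / 2 * Ks"
    using tele[of T] lower[OF XS[of "T + 1"]] by (simp add: Hs_def Rs_def Es_def Ks_def)
  also have "\<dots> \<le> F (X 1) - \<gamma> * \<l> * Hs
      + \<gamma> * (\<l> + u) * ((h 1 + \<gamma> * L * u * Ks) / (1 - \<beta>1) + Es) + \<gamma>\<^sup>2 * L * u\<^sup>2 / 2 * Ks"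
    using Rs pos \<gamma> by (intro add_left_mono add_right_mono mult_left_mono) auto
  also have "\<dots> = F (X 1) + \<gamma> * (- \<l> * Hs
      + (\<l> + u) * ((h 1 + \<gamma> * L * u * Ks) / (1 - \<beta>1) + Es) + \<gamma> * L * u\<^sup>2 / 2 * Ks)"
    by (simp add: algebra_simps power2_eq_square)
  finally have "0 \<le> (F (X 1) - Fstar + \<gamma> * (- \<l> * Hs
      + (\<l> + u) * ((h 1 + \<gamma> * L * u * Ks) / (1 - \<beta>1) + Es) + \<gamma> * L * u\<^sup>2 / 2 * Ks)) / \<gamma>"
    using \<gamma> by simp
  also have "\<dots> = (F (X 1) - Fstar) / \<gamma> + (- \<l> * Hs
      + (\<l> + u) * ((h 1 + \<gamma> * L * u * Ks) / (1 - \<beta>1) + Es) + \<gamma> * L * u\<^sup>2 / 2 * Ks)"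
    using \<gamma> by (simp add: add_divide_distrib)
  also have "(\<l> + u) * ((h 1 + \<gamma> * L * u * Ks) / (1 - \<beta>1) + Es)
      = (\<l> + u) * h 1 / (1 - \<beta>1) + \<gamma> * L * u * (\<l> + u) / (1 - \<beta>1) * Ks + (\<l> + u) * Es"
    by (simp add: algebra_simps add_divide_distrib)
  finally show ?thesis
    unfolding Ks Lhat_def[symmetric] h_def[symmetric] e_def[symmetric] Hs_def[symmetric] Es_def[symmetric]
    by (simp add: algebra_simps add_divide_distrib)
qed

subsection \<open>Measurability and fresh noise\<close>

text \<open>A Caratheodory function is a limit of functions that depend on \<open>X\<close> through a simple function.\<close>

lemma borel_measurable_caratheodory:
  fixes h :: "'a::{second_countable_topology, metric_space} \<Rightarrow> 'x \<Rightarrow> real"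
    and p :: "'b::{second_countable_topology, metric_space} \<Rightarrow> 'a"
  assumes p: "continuous_on UNIV p" "\<And>X. p X \<in> S"
    and meas: "\<And>X. X \<in> S \<Longrightarrow> h X \<in> borel_measurable \<mu>"
    and cont: "\<And>x. x \<in> space \<mu> \<Longrightarrow> continuous_on S (\<lambda>X. h X x)"
  shows "(\<lambda>z. h (p (fst z)) (snd z)) \<in> borel_measurable (borel \<Otimes>\<^sub>M \<mu>)"
proof -
  obtain A where A: "\<And>i. simple_function borel (A i)" "\<And>X. (\<lambda>i. A i X) \<longlonglongrightarrow> (X::'b)"
    using borel_measurable_implies_sequence_metric[of "\<lambda>x::'b. x" borel undefined] by auto
  show ?thesis
  proof (rule borel_measurable_LIMSEQ_real)
    fix z :: "'b \<times> 'x" assume z: "z \<in> space (borel \<Otimes>\<^sub>M \<mu>)"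
    have "(\<lambda>i. p (A i (fst z))) \<longlonglongrightarrow> p (fst z)"
      by (rule continuous_on_tendsto_compose[OF p(1) A(2)]) auto
    then show "(\<lambda>i. h (p (A i (fst z))) (snd z)) \<longlonglongrightarrow> h (p (fst z)) (snd z)"
      using z p(2)
      by (intro continuous_on_tendsto_compose[OF cont[of "snd z"]]) (auto simp: space_pair_measure)
  next
    fix i
    \<comment> \<open>A simple function has finite range, so the approximant is a countable case
      distinction between sections \<open>h (p y)\<close>, each measurable by
      \<open>meas\<close>.\<close>
    have [measurable]: "A i \<in> measurable borel (count_space (range (A i)))"
      using A(1)[of i] by (auto simp: simple_function_def measurable_count_space_eq2)
    show "(\<lambda>z. h (p (A i (fst z))) (snd z)) \<in> borel_measurable (borel \<Otimes>\<^sub>M \<mu>)"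
    proof (rule measurable_compose_countable'[where I="range (A i)" and f="\<lambda>y z. h (p y) (snd z)" and g="\<lambda>z. A i (fst z)"])
      show "countable (range (A i))"
        using A(1)[of i] by (auto simp: simple_function_def intro: countable_finite)
    qed (use meas p(2) in measurable)
  qed
qed

text \<open>Coordinates of the gradient in an orthonormal basis of \<open>S\<close> are limits of
  difference quotients, and each quotient is a Caratheodory function. The gradient lies in
  \<open>S\<close>, so these coordinates determine it.\<close>

lemma borel_measurable_gradient_on:
  fixes S :: "'a::euclidean_space set" and p :: "'a \<Rightarrow> 'a" and h :: "'a \<Rightarrow> 'x \<Rightarrow> real"
  assumes S: "subspace S"
    and p: "continuous_on UNIV p" "\<And>X. p X \<in> S"
    and meas: "\<And>X. X \<in> S \<Longrightarrow> h X \<in> borel_measurable \<mu>"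
    and diff: "\<And>x X. x \<in> space \<mu> \<Longrightarrow> X \<in> S \<Longrightarrow> (\<lambda>Y. h Y x) differentiable (at X within S)"
  shows "(\<lambda>z. gradient_on S (\<lambda>Y. h Y (snd z)) (p (fst z))) \<in> borel_measurable (borel \<Otimes>\<^sub>M \<mu>)"
proof -
  have cont: "continuous_on S (\<lambda>X. h X x)" if "x \<in> space \<mu>" for x
    using diff[OF that] by (intro differentiable_imp_continuous_on) (auto simp: differentiable_on_def)
  obtain B where B: "B \<subseteq> S" "pairwise orthogonal B" "\<And>x. x \<in> B \<Longrightarrow> norm x = 1"
    "finite B" "span B = S"
    using orthonormal_basis_subspace[OF S] independent_imp_finite by metis
  define g where "g z = gradient_on S (\<lambda>Y. h Y (snd z)) (p (fst z))" for z
  have coord: "(\<lambda>z. g z \<bullet> e) \<in> borel_measurable (borel \<Otimes>\<^sub>M \<mu>)" if e: "e \<in> B" for e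
  proof (rule borel_measurable_LIMSEQ_real)
    fix z :: "'a \<times> 'x" assume z: "z \<in> space (borel \<Otimes>\<^sub>M \<mu>)"
    have mem: "p (fst z) + 0 *\<^sub>R e \<in> S" using p(2) by simp
    have "((\<lambda>s. h (p (fst z) + s *\<^sub>R e) (snd z)) has_real_derivative g z \<bullet> e) (at 0)"
      using gradient_on_line_derivative[OF S mem, of "\<lambda>Y. h Y (snd z)"] e B(1) z diff p(2)
      by (auto simp: g_def space_pair_measure)
    then have "((\<lambda>s. (h (p (fst z) + s *\<^sub>R e) (snd z) - h (p (fst z)) (snd z)) / s) \<longlongrightarrow> g z \<bullet> e) (at 0)"
      by (simp add: DERIV_def)
    moreover have "filterlim (\<lambda>n. 1 / real (Suc n)) (at 0) sequentially"
      using LIMSEQ_inverse_real_of_nat by (simp add: filterlim_at inverse_eq_divide)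
    ultimately show "(\<lambda>n. (h (p (fst z) + (1 / real (Suc n)) *\<^sub>R e) (snd z) - h (p (fst z)) (snd z))
        / (1 / real (Suc n))) \<longlonglongrightarrow> g z \<bullet> e"
      by (rule filterlim_compose)
  next
    fix n
    have "(\<lambda>z. h (p (fst z) + c *\<^sub>R e) (snd z)) \<in> borel_measurable (borel \<Otimes>\<^sub>M \<mu>)" for c
      using p e B(1) S
      by (intro borel_measurable_caratheodory[where p = "\<lambda>X. p X + c *\<^sub>R e" and S = S] meas cont
          continuous_intros subspace_add subspace_scale) auto
    from this[of "1 / real (Suc n)"] this[of 0]
    show "(\<lambda>z. (h (p (fst z) + (1 / real (Suc n)) *\<^sub>R e) (snd z) - h (p (fst z)) (snd z))
        / (1 / real (Suc n))) \<in> borel_measurable (borel \<Otimes>\<^sub>M \<mu>)"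
      by (intro borel_measurable_divide borel_measurable_diff) auto
  qed
  have "(\<lambda>z. \<Sum>e\<in>B. (g z \<bullet> e) *\<^sub>R e) \<in> borel_measurable (borel \<Otimes>\<^sub>M \<mu>)"
    by (intro borel_measurable_sum borel_measurable_scaleR coord) auto
  moreover have "g z = (\<Sum>e\<in>B. (g z \<bullet> e) *\<^sub>R e)" if "z \<in> space (borel \<Otimes>\<^sub>M \<mu>)" for z
  proof -
    have "g z \<in> span B"
      using that gradient_on_works(1)[OF S p(2) diff] p(2) B(5) by (auto simp: g_def space_pair_measure)
    then show ?thesis
      using orthonormal_expansion[of B "g z"] B by (simp add: inner_commute)
  qed
  ultimately show ?thesis
    unfolding g_def[symmetric] by (subst measurable_cong) auto
qed

text \<open>At a fixed \<open>X\<close> the smoothness constant is a fixed number, positive because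
  \<open>L0\<close> is, so the radius \<open>e / K\<close> works.\<close>

lemma continuous_on_gradient_on:
  assumes "joint_smooth S F L0 L1 q"
  shows "continuous_on S (gradient_on S F)"
proof (rule continuous_on_iff[THEN iffD2], clarify)
  fix X and e :: real assume X: "X \<in> S" and e: "e > 0"
  define K where "K = L0 + L1 * grad_power (norm (gradient_on S F X)) q"
  have K: "K > 0"
    using assms by (auto simp: K_def joint_smooth_def grad_power_def intro!: add_pos_nonneg)
  have "dist (gradient_on S F Y) (gradient_on S F X) < e" if "Y \<in> S" "dist Y X < e / K" for Y
  proof -
    have "norm (gradient_on S F X - gradient_on S F Y) \<le> K * norm (X - Y)"
      using assms X that(1) unfolding joint_smooth_def K_def by blast
    also have "\<dots> < e"
      using that(2) K by (simp add: dist_norm norm_minus_commute field_simps)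
    finally show ?thesis by (simp add: dist_norm norm_minus_commute)
  qed
  then show "\<exists>d>0. \<forall>Y\<in>S. dist Y X < d \<longrightarrow> dist (gradient_on S F Y) (gradient_on S F X) < e"
    using e K by (intro exI[of _ "e / K"]) auto
qed

text \<open>Independence identifies the two measures on rectangles. The product form lets Fubini
  replace conditioning on the past; \<open>Y\<close> may take values in any measurable space, so
  several past quantities can be bundled.\<close>

lemma (in prob_space) fresh_sample_joint_law:
  assumes sub: "subalgebra M H" and Y: "Y \<in> measurable H N" and \<xi>[measurable]: "\<xi> \<in> measurable M \<mu>"
    and law: "distr M \<mu> \<xi> = \<mu>"
    and indep: "indep_set (sets H) {\<xi> -` A \<inter> space M | A. A \<in> sets \<mu>}"
  shows "distr M (N \<Otimes>\<^sub>M \<mu>) (\<lambda>\<omega>. (Y \<omega>, \<xi> \<omega>)) = distr M N Y \<Otimes>\<^sub>M \<mu>"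
proof -
  have Y'[measurable]: "Y \<in> measurable M N" by (rule measurable_from_subalg[OF sub Y])
  have "prob_space \<mu>" using prob_space_distr[OF \<xi>] law by simp
  have "distr M N Y \<Otimes>\<^sub>M \<mu> = distr M (N \<Otimes>\<^sub>M \<mu>) (\<lambda>\<omega>. (Y \<omega>, \<xi> \<omega>))"
  proof (rule pair_measure_eqI)
    show "sigma_finite_measure (distr M N Y)" "sigma_finite_measure \<mu>"
      using prob_space_distr[OF Y'] \<open>prob_space \<mu>\<close> by (auto intro: prob_space_imp_sigma_finite)
    show "sets (distr M N Y \<Otimes>\<^sub>M \<mu>) = sets (distr M (N \<Otimes>\<^sub>M \<mu>) (\<lambda>\<omega>. (Y \<omega>, \<xi> \<omega>)))"
      by simp
    fix A B assume A: "A \<in> sets (distr M N Y)" and B: "B \<in> sets \<mu>"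
    have "Y -` A \<inter> space M \<in> sets H"
      using measurable_sets[OF Y] A sub by (simp add: subalgebra_def)
    then have "prob ((Y -` A \<inter> space M) \<inter> (\<xi> -` B \<inter> space M))
        = prob (Y -` A \<inter> space M) * prob (\<xi> -` B \<inter> space M)"
      using B by (intro indep_setD[OF indep]) auto
    moreover have "(Y -` A \<inter> space M) \<inter> (\<xi> -` B \<inter> space M) = (\<lambda>\<omega>. (Y \<omega>, \<xi> \<omega>)) -` (A \<times> B) \<inter> space M"
      by auto
    moreover have "emeasure \<mu> B = emeasure M (\<xi> -` B \<inter> space M)"
      using B law emeasure_distr[OF \<xi>, of B] by simp
    ultimately show "emeasure (distr M N Y) A * emeasure \<mu> B
        = emeasure (distr M (N \<Otimes>\<^sub>M \<mu>) (\<lambda>\<omega>. (Y \<omega>, \<xi> \<omega>))) (A \<times> B)"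
      using A B by (simp add: emeasure_distr emeasure_eq_measure ennreal_mult)
  qed
  then show ?thesis by simp
qed

text \<open>Nonnegativity of the variance bounds the squared mean by the second moment.\<close>

lemma (in prob_space) expectation_norm_le_sqrt:
  assumes "U \<in> borel_measurable M" "integrable M (\<lambda>\<omega>. (norm (U \<omega>))\<^sup>2)"
    and le: "expectation (\<lambda>\<omega>. (norm (U \<omega>))\<^sup>2) \<le> c"
  shows "integrable M (\<lambda>\<omega>. norm (U \<omega>))" and "expectation (\<lambda>\<omega>. norm (U \<omega>)) \<le> sqrt c"
proof -
  show int: "integrable M (\<lambda>\<omega>. norm (U \<omega>))"
    by (rule square_integrable_imp_integrable) (use assms in auto)
  have "(expectation (\<lambda>\<omega>. norm (U \<omega>)))\<^sup>2 \<le> expectation (\<lambda>\<omega>. (norm (U \<omega>))\<^sup>2)"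
    using variance_eq[OF int assms(2)] variance_positive[of "\<lambda>\<omega>. norm (U \<omega>)"] by simp
  then show "expectation (\<lambda>\<omega>. norm (U \<omega>)) \<le> sqrt c"
    using le by (intro real_le_rsqrt) simp
qed

text \<open>Integrate over the fresh sample first, with the past frozen at \<open>y\<close>. The
  computation uses nonnegative integrals, so it yields integrability along with the bound.\<close>

lemma (in prob_space) fresh_noise_second_moment:
  fixes n :: "'y \<Rightarrow> 'x \<Rightarrow> 'b::euclidean_space"
  assumes sub: "subalgebra M H" and Y: "Y \<in> measurable H N" and \<xi>[measurable]: "\<xi> \<in> measurable M \<mu>"
    and law: "distr M \<mu> \<xi> = \<mu>"
    and indep: "indep_set (sets H) {\<xi> -` A \<inter> space M | A. A \<in> sets \<mu>}"
    and n[measurable]: "(\<lambda>z. n (fst z) (snd z)) \<in> borel_measurable (N \<Otimes>\<^sub>M \<mu>)"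
    and int: "\<And>y. y \<in> space N \<Longrightarrow> integrable \<mu> (\<lambda>x. (norm (n y x))\<^sup>2)"
    and le: "\<And>y. y \<in> space N \<Longrightarrow> (\<integral>x. (norm (n y x))\<^sup>2 \<partial>\<mu>) \<le> c"
    and c: "0 \<le> c"
  shows "integrable M (\<lambda>\<omega>. (norm (n (Y \<omega>) (\<xi> \<omega>)))\<^sup>2)"
    and "expectation (\<lambda>\<omega>. (norm (n (Y \<omega>) (\<xi> \<omega>)))\<^sup>2) \<le> c"
proof -
  have Y'[measurable]: "Y \<in> measurable M N" by (rule measurable_from_subalg[OF sub Y])
  interpret \<mu>: prob_space \<mu> using prob_space_distr[OF \<xi>] law by simp
  interpret N: prob_space "distr M N Y" by (rule prob_space_distr[OF Y'])
  have nm: "(\<lambda>\<omega>. n (Y \<omega>) (\<xi> \<omega>)) \<in> borel_measurable M"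
    using measurable_compose[OF measurable_Pair[OF Y' \<xi>] n] by simp
  have "(\<integral>\<^sup>+\<omega>. ennreal ((norm (n (Y \<omega>) (\<xi> \<omega>)))\<^sup>2) \<partial>M)
      = (\<integral>\<^sup>+z. ennreal ((norm (n (fst z) (snd z)))\<^sup>2) \<partial>(distr M N Y \<Otimes>\<^sub>M \<mu>))"
    unfolding fresh_sample_joint_law[OF sub Y \<xi> law indep, symmetric]
    by (subst nn_integral_distr) auto
  also have "\<dots> = (\<integral>\<^sup>+y. \<integral>\<^sup>+x. ennreal ((norm (n y x))\<^sup>2) \<partial>\<mu> \<partial>distr M N Y)"
    by (subst \<mu>.nn_integral_fst[symmetric]) auto
  also have "\<dots> \<le> (\<integral>\<^sup>+y. ennreal c \<partial>distr M N Y)"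
    by (intro nn_integral_mono) (auto simp: nn_integral_eq_integral int le ennreal_leI)
  also have "\<dots> = ennreal c" using N.emeasure_space_1 by simp
  finally have bound: "(\<integral>\<^sup>+\<omega>. ennreal ((norm (n (Y \<omega>) (\<xi> \<omega>)))\<^sup>2) \<partial>M) \<le> ennreal c" .
  show int: "integrable M (\<lambda>\<omega>. (norm (n (Y \<omega>) (\<xi> \<omega>)))\<^sup>2)"
    using nm bound by (intro integrableI_bounded) (auto intro: le_less_trans)
  show "expectation (\<lambda>\<omega>. (norm (n (Y \<omega>) (\<xi> \<omega>)))\<^sup>2) \<le> c"
    using bound nn_integral_eq_integral[OF int] c by simp
qed

text \<open>With the past frozen, the inner integral is the inner product of a constant with the
  zero mean. Square integrability of both factors justifies Fubini.\<close>

lemma (in prob_space) fresh_noise_uncorrelated: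
  fixes n :: "'y \<Rightarrow> 'x \<Rightarrow> 'b::euclidean_space"
  assumes sub: "subalgebra M H" and Y: "Y \<in> measurable H N" and \<xi>[measurable]: "\<xi> \<in> measurable M \<mu>"
    and law: "distr M \<mu> \<xi> = \<mu>"
    and indep: "indep_set (sets H) {\<xi> -` A \<inter> space M | A. A \<in> sets \<mu>}"
    and n[measurable]: "(\<lambda>z. n (fst z) (snd z)) \<in> borel_measurable (N \<Otimes>\<^sub>M \<mu>)"
    and int: "\<And>y. y \<in> space N \<Longrightarrow> integrable \<mu> (n y)"
    and mean: "\<And>y. y \<in> space N \<Longrightarrow> (\<integral>x. n y x \<partial>\<mu>) = 0"
    and U: "U \<in> borel_measurable H" and U2: "integrable M (\<lambda>\<omega>. (norm (U \<omega>))\<^sup>2)"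
    and n2: "integrable M (\<lambda>\<omega>. (norm (n (Y \<omega>) (\<xi> \<omega>)))\<^sup>2)"
  shows "integrable M (\<lambda>\<omega>. U \<omega> \<bullet> n (Y \<omega>) (\<xi> \<omega>))"
    and "expectation (\<lambda>\<omega>. U \<omega> \<bullet> n (Y \<omega>) (\<xi> \<omega>)) = 0"
proof -
  have Y'[measurable]: "Y \<in> measurable M N" by (rule measurable_from_subalg[OF sub Y])
  have U'[measurable]: "U \<in> borel_measurable M" by (rule measurable_from_subalg[OF sub U])
  have nm[measurable]: "(\<lambda>\<omega>. n (Y \<omega>) (\<xi> \<omega>)) \<in> borel_measurable M"
    using measurable_compose[OF measurable_Pair[OF Y' \<xi>] n] by simp
  show int': "integrable M (\<lambda>\<omega>. U \<omega> \<bullet> n (Y \<omega>) (\<xi> \<omega>))"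
  proof (rule Bochner_Integration.integrable_bound)
    show "integrable M (\<lambda>\<omega>. (norm (U \<omega>))\<^sup>2 + (norm (n (Y \<omega>) (\<xi> \<omega>)))\<^sup>2)"
      using U2 n2 by simp
    have "\<bar>a \<bullet> b\<bar> \<le> (norm a)\<^sup>2 + (norm b)\<^sup>2" for a b :: 'b
    proof -
      have "\<bar>a \<bullet> b\<bar> \<le> norm a * norm b" by (rule Cauchy_Schwarz_ineq2)
      also have "\<dots> \<le> (norm a)\<^sup>2 + (norm b)\<^sup>2"
        using sum_squares_bound[of "norm a" "norm b"] mult_nonneg_nonneg[OF norm_ge_zero norm_ge_zero, of a b]
        by linarith
      finally show ?thesis .
    qed
    then show "AE \<omega> in M. norm (U \<omega> \<bullet> n (Y \<omega>) (\<xi> \<omega>)) \<le> norm ((norm (U \<omega>))\<^sup>2 + (norm (n (Y \<omega>) (\<xi> \<omega>)))\<^sup>2)"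
      by simp
  qed measurable
  \<comment> \<open>\<open>U\<close> need not be a function of \<open>Y\<close>, so the two are
    frozen jointly.\<close>
  define Z where "Z \<omega> = (U \<omega>, Y \<omega>)" for \<omega>
  define k where "k z = fst (fst z) \<bullet> n (snd (fst z)) (snd z)" for z :: "('b \<times> 'y) \<times> 'x"
  have Z: "Z \<in> measurable H (borel \<Otimes>\<^sub>M N)" unfolding Z_def using U Y by measurable
  then have Z'[measurable]: "Z \<in> measurable M (borel \<Otimes>\<^sub>M N)" by (rule measurable_from_subalg[OF sub])
  have "(\<lambda>z. n (snd (fst z)) (snd z)) \<in> borel_measurable ((borel \<Otimes>\<^sub>M N) \<Otimes>\<^sub>M \<mu> :: (('b \<times> 'y) \<times> 'x) measure)"
    using measurable_compose[of "\<lambda>z::('b \<times> 'y) \<times> 'x. (snd (fst z), snd z)" "(borel \<Otimes>\<^sub>M N) \<Otimes>\<^sub>M \<mu>", OF _ n]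
    by simp
  then have k[measurable]: "k \<in> borel_measurable ((borel \<Otimes>\<^sub>M N) \<Otimes>\<^sub>M \<mu>)"
    unfolding k_def[abs_def] by measurable
  interpret \<mu>: prob_space \<mu> using prob_space_distr[OF \<xi>] law by simp
  interpret D: prob_space "distr M (borel \<Otimes>\<^sub>M N) Z" by (rule prob_space_distr[OF Z'])
  interpret pair_sigma_finite "distr M (borel \<Otimes>\<^sub>M N) Z" \<mu> ..
  note joint = fresh_sample_joint_law[OF sub Z \<xi> law indep]
  have kZ: "k (Z \<omega>, \<xi> \<omega>) = U \<omega> \<bullet> n (Y \<omega>) (\<xi> \<omega>)" for \<omega> by (simp add: k_def Z_def)
  have ik: "integrable (distr M (borel \<Otimes>\<^sub>M N) Z \<Otimes>\<^sub>M \<mu>) k"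
    unfolding joint[symmetric] by (subst integrable_distr_eq) (auto simp: kZ int')
  have "expectation (\<lambda>\<omega>. U \<omega> \<bullet> n (Y \<omega>) (\<xi> \<omega>)) = integral\<^sup>L (distr M (borel \<Otimes>\<^sub>M N) Z \<Otimes>\<^sub>M \<mu>) k"
    unfolding joint[symmetric] by (subst integral_distr) (auto simp: kZ)
  also have "\<dots> = (\<integral>y. \<integral>x. k (y, x) \<partial>\<mu> \<partial>distr M (borel \<Otimes>\<^sub>M N) Z)"
    using integral_fst'[OF ik] by simp
  also have "\<dots> = (\<integral>y. 0 \<partial>distr M (borel \<Otimes>\<^sub>M N) Z)"
    by (intro Bochner_Integration.integral_cong refl)
       (auto simp: k_def space_pair_measure integral_inner_right int mean)
  finally show "expectation (\<lambda>\<omega>. U \<omega> \<bullet> n (Y \<omega>) (\<xi> \<omega>)) = 0" by simp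
qed

subsection \<open>The stochastic run\<close>

lemma power2_norm_lincomb:
  fixes x y :: "'a::real_inner"
  shows "(norm (a *\<^sub>R x + b *\<^sub>R y))\<^sup>2 = a\<^sup>2 * (norm x)\<^sup>2 + 2 * a * b * (x \<bullet> y) + b\<^sup>2 * (norm y)\<^sup>2"
  unfolding power2_norm_eq_inner
  by (simp add: inner_simps inner_commute power2_eq_square algebra_simps)

lemma nth_measurable: "(\<lambda>x. x $ l) \<in> borel_measurable (borel :: (('a::euclidean_space) ^ 'k::finite) measure)"
  by (intro borel_measurable_continuous_onI continuous_intros)

text \<open>Orthogonalization enters through measurability, invariance of \<open>S\<close> and the
  two norm inequalities. The auxiliary processes of \<open>muon_run\<close> become parameters, and
  the layer equations become equations between whole vectors.\<close>

locale stochastic_muon =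
  fixes P :: "'w measure" and H :: "nat \<Rightarrow> 'w measure" and \<mu> :: "'x measure" and T :: nat
    and \<xi> :: "nat \<Rightarrow> 'w \<Rightarrow> 'x"
    and S :: "(real ^ 'm::finite ^ 'n::finite ^ 'l::finite) set"
    and f :: "real ^ 'm ^ 'n ^ 'l \<Rightarrow> 'x \<Rightarrow> real" and F :: "real ^ 'm ^ 'n ^ 'l \<Rightarrow> real"
    and Fstar L0 L1 q :: real and \<sigma> :: "'l \<Rightarrow> real"
    and orth :: "real ^ 'm ^ 'n \<Rightarrow> real ^ 'm ^ 'n" and \<l> u :: real
    and \<gamma> \<beta>1 \<beta>2 :: real and X1 :: "real ^ 'm ^ 'n ^ 'l"
    and X G M N Q :: "nat \<Rightarrow> 'w \<Rightarrow> real ^ 'm ^ 'n ^ 'l"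
  assumes subspace_S: "subspace S"
    and objective: "stochastic_objective S \<mu> f F"
    and lower: "\<And>Y. Y \<in> S \<Longrightarrow> Fstar \<le> F Y"
    and smooth: "joint_smooth S F L0 L1 q"
    and variance: "layerwise_variance S \<mu> f F \<sigma>"
    and X1: "X1 \<in> S"
    and fresh: "fresh_samples P H \<mu> T \<xi>"
    and T: "1 \<le> T" and \<gamma>: "0 < \<gamma>"
    and \<beta>1: "0 \<le> \<beta>1" "\<beta>1 < 1" and \<beta>2: "0 \<le> \<beta>2" "\<beta>2 \<le> 1"
    and pos: "0 \<le> \<l>" "0 \<le> u"
    and orth_measurable: "orth \<in> borel_measurable borel"
    and orth_inner: "\<And>Z. \<l> * norm Z \<le> Z \<bullet> orth Z"
    and orth_norm: "\<And>Z. norm (orth Z) \<le> u"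
    and orth_S: "\<And>Y. Y \<in> S \<Longrightarrow> (\<chi> l. orth (Y $ l)) \<in> S"
    and X_1: "\<And>\<omega>. \<omega> \<in> space P \<Longrightarrow> X 1 \<omega> = X1"
    and M_0: "\<And>\<omega>. \<omega> \<in> space P \<Longrightarrow> M 0 \<omega> = 0"
    and G_eq: "\<And>t \<omega>. t \<in> {1..T} \<Longrightarrow> \<omega> \<in> space P \<Longrightarrow>
      G t \<omega> = gradient_on S (\<lambda>Y. f Y (\<xi> t \<omega>)) (X t \<omega>)"
    and M_eq: "\<And>t \<omega>. t \<in> {1..T} \<Longrightarrow> \<omega> \<in> space P \<Longrightarrow>
      M t \<omega> = \<beta>1 *\<^sub>R M (t - 1) \<omega> + (1 - \<beta>1) *\<^sub>R G t \<omega>"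
    and N_eq: "\<And>t \<omega>. t \<in> {1..T} \<Longrightarrow> \<omega> \<in> space P \<Longrightarrow>
      N t \<omega> = \<beta>2 *\<^sub>R M t \<omega> + (1 - \<beta>2) *\<^sub>R G t \<omega>"
    and Q_eq: "\<And>t \<omega>. t \<in> {1..T} \<Longrightarrow> \<omega> \<in> space P \<Longrightarrow> Q t \<omega> = (\<chi> l. orth (N t \<omega> $ l))"
    and X_eq: "\<And>t \<omega>. t \<in> {1..T} \<Longrightarrow> \<omega> \<in> space P \<Longrightarrow> X (t + 1) \<omega> = X t \<omega> - \<gamma> *\<^sub>R Q t \<omega>"
begin

sublocale prob_space P
  using fresh by (simp add: fresh_samples_def)

lemma subalgebra_H: "subalgebra P (H t)"
  using fresh by (simp add: fresh_samples_def)

lemma space_H [simp]: "space (H t) = space P"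
  using subalgebra_H by (simp add: subalgebra_def)

lemma H_mono: "Y \<in> measurable (H s) K \<Longrightarrow> s \<le> t \<Longrightarrow> Y \<in> measurable (H t) K"
proof -
  assume Y: "Y \<in> measurable (H s) K" and st: "s \<le> t"
  have "subalgebra (H t) (H s)"
    using fresh filtration.sets_F_mono[OF _ st, of "space P" H] by (simp add: fresh_samples_def subalgebra_def)
  then show ?thesis using Y by (rule measurable_from_subalg)
qed

lemma \<xi>_measurable: "t \<in> {1..T} \<Longrightarrow> \<xi> t \<in> measurable (H t) \<mu>"
  using fresh by (simp add: fresh_samples_def)

lemma \<xi>_measurable': "t \<in> {1..T} \<Longrightarrow> \<xi> t \<in> measurable P \<mu>"
  using \<xi>_measurable subalgebra_H by (blast intro: measurable_from_subalg)

text \<open>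
  Gradients are defined only on \<open>S\<close>; precomposing with the projection onto \<open>S\<close> makes them Borel
  functions on the whole space.
\<close>

definition proj :: "real ^ 'm ^ 'n ^ 'l \<Rightarrow> real ^ 'm ^ 'n ^ 'l" where
  "proj = closest_point S"

lemma proj_S: "proj Y \<in> S" and proj_id: "Y \<in> S \<Longrightarrow> proj Y = Y"
  and continuous_proj: "continuous_on UNIV proj"
proof -
  have "closed S" "convex S" "S \<noteq> {}"
    using subspace_S X1 closed_subspace subspace_imp_convex by auto
  then show "proj Y \<in> S" "Y \<in> S \<Longrightarrow> proj Y = Y" "continuous_on UNIV proj"
    by (auto simp: proj_def closest_point_in_set closest_point_self continuous_on_closest_point)
qed

abbreviation sgrad :: "real ^ 'm ^ 'n ^ 'l \<Rightarrow> 'x \<Rightarrow> real ^ 'm ^ 'n ^ 'l" where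
  "sgrad Y x \<equiv> gradient_on S (\<lambda>Y. f Y x) (proj Y)"

definition noise :: "real ^ 'm ^ 'n ^ 'l \<Rightarrow> 'x \<Rightarrow> real ^ 'm ^ 'n ^ 'l" where
  "noise Y x = sgrad Y x - gradient_on S F (proj Y)"

lemma sgrad_measurable: "(\<lambda>z. sgrad (fst z) (snd z)) \<in> borel_measurable (borel \<Otimes>\<^sub>M \<mu>)"
  using objective continuous_proj proj_S
  by (intro borel_measurable_gradient_on subspace_S) (auto simp: stochastic_objective_def)

lemma sgrad_S: "x \<in> space \<mu> \<Longrightarrow> sgrad Y x \<in> S"
  using objective proj_S by (intro gradient_on_works subspace_S) (auto simp: stochastic_objective_def)

lemma grad_measurable: "(\<lambda>Y. gradient_on S F (proj Y)) \<in> borel_measurable borel"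
  by (intro borel_measurable_continuous_onI continuous_on_compose2[OF continuous_on_gradient_on[OF smooth]
        continuous_proj]) (auto simp: proj_S)

lemma noise_measurable: "(\<lambda>z. noise (fst z) (snd z)) \<in> borel_measurable (borel \<Otimes>\<^sub>M \<mu>)"
  unfolding noise_def
  by (intro borel_measurable_diff sgrad_measurable measurable_compose[OF measurable_fst grad_measurable])

lemma orth_layers_measurable: "(\<lambda>Y. \<chi> l. orth (Y $ l)) \<in> borel_measurable (borel :: (real ^ 'm ^ 'n ^ 'l) measure)"
proof (subst borel_measurable_euclidean_space, rule ballI)
  fix b :: "real ^ 'm ^ 'n ^ 'l" assume "b \<in> Basis"
  then obtain l c where b: "b = axis l c" by (auto simp: Basis_vec_def)
  have [measurable]: "(\<lambda>Y::real ^ 'm ^ 'n ^ 'l. orth (Y $ l)) \<in> borel_measurable borel"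
    by (rule measurable_compose[OF _ orth_measurable])
       (intro borel_measurable_continuous_onI continuous_intros)
  show "(\<lambda>Y::real ^ 'm ^ 'n ^ 'l. (\<chi> l. orth (Y $ l)) \<bullet> b) \<in> borel_measurable borel"
    by (simp add: b inner_axis)
qed

text \<open>The induction must carry the momentum, which feeds the next step, and membership in
  \<open>S\<close>, where the projection is the identity. The index shift reflects that
  \<open>X (Suc t)\<close> is known once step \<open>t\<close> is done.\<close>

lemma run_adapted:
  assumes "t \<le> T"
  shows "X (Suc t) \<in> borel_measurable (H t) \<and> M t \<in> borel_measurable (H t)
    \<and> (\<forall>\<omega>\<in>space P. X (Suc t) \<omega> \<in> S \<and> M t \<omega> \<in> S)"
  using assms
proof (induction t)
  case 0
  have "X (Suc 0) \<in> borel_measurable (H 0) \<longleftrightarrow> (\<lambda>_. X1) \<in> borel_measurable (H 0)"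
    by (rule measurable_cong) (use X_1 in simp)
  moreover have "M 0 \<in> borel_measurable (H 0) \<longleftrightarrow> (\<lambda>_. 0 :: real ^ 'm ^ 'n ^ 'l) \<in> borel_measurable (H 0)"
    by (rule measurable_cong) (use M_0 in simp)
  ultimately show ?case
    using X_1 M_0 X1 subspace_0[OF subspace_S] by simp
next
  case (Suc t)
  let ?s = "Suc t"
  have s: "?s \<in> {1..T}" using Suc.prems by simp
  have X: "X ?s \<in> borel_measurable (H ?s)" and M: "M t \<in> borel_measurable (H ?s)"
    and mem: "\<And>\<omega>. \<omega> \<in> space P \<Longrightarrow> X ?s \<omega> \<in> S \<and> M t \<omega> \<in> S"
    using Suc by (auto intro: H_mono[of _ t])
  \<comment> \<open>\<open>G\<close> is specified only on \<open>space P\<close>. Its substitute is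
    visibly a jointly Borel function of iterate and sample, and agrees with it there.\<close>
  define G' where "G' \<omega> = sgrad (X ?s \<omega>) (\<xi> ?s \<omega>)" for \<omega>
  have [measurable]: "G' \<in> borel_measurable (H ?s)"
    unfolding G'_def
    using measurable_compose[OF measurable_Pair[OF X \<xi>_measurable[OF s]] sgrad_measurable] by simp
  note [measurable] = X M orth_layers_measurable
  have G: "G ?s \<omega> = G' \<omega>" if "\<omega> \<in> space P" for \<omega>
    using that mem by (simp add: G_eq[OF s] G'_def proj_id)
  have GS: "G' \<omega> \<in> S" if "\<omega> \<in> space P" for \<omega>
    unfolding G'_def using measurable_space[OF \<xi>_measurable[OF s]] that by (intro sgrad_S) simp
  define M' where "M' \<omega> = \<beta>1 *\<^sub>R M t \<omega> + (1 - \<beta>1) *\<^sub>R G' \<omega>" for \<omega>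
  define N' where "N' \<omega> = \<beta>2 *\<^sub>R M' \<omega> + (1 - \<beta>2) *\<^sub>R G' \<omega>" for \<omega>
  define X' where "X' \<omega> = X ?s \<omega> - \<gamma> *\<^sub>R (\<chi> l. orth (N' \<omega> $ l))" for \<omega>
  have M': "M ?s \<omega> = M' \<omega>" if "\<omega> \<in> space P" for \<omega>
    using that by (simp add: M_eq[OF s] M'_def G)
  have X': "X (Suc ?s) \<omega> = X' \<omega>" if "\<omega> \<in> space P" for \<omega>
    using that X_eq[OF s] by (simp add: X'_def Q_eq[OF s] N_eq[OF s] N'_def M' G)
  have [measurable]: "M' \<in> borel_measurable (H ?s)" unfolding M'_def[abs_def] by measurable
  have [measurable]: "N' \<in> borel_measurable (H ?s)" unfolding N'_def[abs_def] by measurable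
  have "(\<lambda>\<omega>. \<chi> l. orth (N' \<omega> $ l)) \<in> borel_measurable (H ?s)"
    by (rule measurable_compose[OF _ orth_layers_measurable]) measurable
  then have "X' \<in> borel_measurable (H ?s)" unfolding X'_def[abs_def] by measurable
  moreover have "X (Suc ?s) \<in> borel_measurable (H ?s) \<longleftrightarrow> X' \<in> borel_measurable (H ?s)"
    "M ?s \<in> borel_measurable (H ?s) \<longleftrightarrow> M' \<in> borel_measurable (H ?s)"
    by (rule measurable_cong, use X' M' in simp)+
  moreover have "M' \<omega> \<in> S" if "\<omega> \<in> space P" for \<omega>
    unfolding M'_def by (intro subspace_add subspace_scale subspace_S GS that) (use mem that in auto)
  moreover from this have "X' \<omega> \<in> S" if "\<omega> \<in> space P" for \<omega>
    unfolding X'_def N'_def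
    by (intro subspace_diff subspace_scale subspace_S orth_S subspace_add GS that)
       (use mem that in auto)
  ultimately show ?case using X' M' by simp
qed

lemma X_adapted: "t \<in> {1..T} \<Longrightarrow> X t \<in> borel_measurable (H (t - 1))"
  using run_adapted[of "t - 1"] by auto

lemma X_S: "t \<in> {1..T+1} \<Longrightarrow> \<omega> \<in> space P \<Longrightarrow> X t \<omega> \<in> S"
  using run_adapted[of "t - 1"] by auto

section \<open>Moments of the noise and of its exponential average\<close>

lemma G_noise: "t \<in> {1..T} \<Longrightarrow> \<omega> \<in> space P \<Longrightarrow>
    G t \<omega> - gradient_on S F (X t \<omega>) = noise (X t \<omega>) (\<xi> t \<omega>)"
  using X_S[of t \<omega>] by (simp add: noise_def G_eq proj_id)

text \<open>The projection lies in \<open>S\<close>, so the variance assumption holds at every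
  \<open>Y\<close>, as the Fubini lemmas require.\<close>

lemma noise_nth_moments:
  shows "integrable \<mu> (\<lambda>x. noise Y x $ l)" and "(\<integral>x. noise Y x $ l \<partial>\<mu>) = 0"
    and "integrable \<mu> (\<lambda>x. (norm (noise Y x $ l))\<^sup>2)"
    and "(\<integral>x. (norm (noise Y x $ l))\<^sup>2 \<partial>\<mu>) \<le> (\<sigma> l)\<^sup>2"
proof -
  interpret \<mu>: prob_space \<mu> using objective by (simp add: stochastic_objective_def)
  note v = variance[unfolded layerwise_variance_def, rule_format, of l]
  show "integrable \<mu> (\<lambda>x. noise Y x $ l)" "(\<integral>x. noise Y x $ l \<partial>\<mu>) = 0"
    "integrable \<mu> (\<lambda>x. (norm (noise Y x $ l))\<^sup>2)"
    "(\<integral>x. (norm (noise Y x $ l))\<^sup>2 \<partial>\<mu>) \<le> (\<sigma> l)\<^sup>2"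
    using v proj_S[of Y] by (auto simp: noise_def \<mu>.prob_space)
qed

lemma \<sigma>_nonneg: "0 \<le> \<sigma> l"
  using variance by (simp add: layerwise_variance_def)

lemma noise_nth_measurable: "(\<lambda>z. noise (fst z) (snd z) $ l) \<in> borel_measurable (borel \<Otimes>\<^sub>M \<mu>)"
  by (rule measurable_compose[OF noise_measurable nth_measurable])

lemma fresh_step:
  assumes "t \<in> {1..T}"
  shows "distr P \<mu> (\<xi> t) = \<mu>" "indep_set (sets (H (t - 1))) {\<xi> t -` A \<inter> space P | A. A \<in> sets \<mu>}"
  using fresh assms by (auto simp: fresh_samples_def)

lemma noise_second_moment:
  assumes t: "t \<in> {1..T}"
  shows "integrable P (\<lambda>\<omega>. (norm (noise (X t \<omega>) (\<xi> t \<omega>) $ l))\<^sup>2)"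
    and "expectation (\<lambda>\<omega>. (norm (noise (X t \<omega>) (\<xi> t \<omega>) $ l))\<^sup>2) \<le> (\<sigma> l)\<^sup>2"
  using fresh_noise_second_moment[OF subalgebra_H X_adapted[OF t] \<xi>_measurable'[OF t] fresh_step[OF t]
      noise_nth_measurable[of l] noise_nth_moments(3,4)] by simp_all

text \<open>The momentum recursion driven by the noise alone. The recursive form suits both the
  pathwise bound, where it plays the part of \<open>V\<close>, and the inductive second moment
  estimate.\<close>

primrec avg_noise :: "nat \<Rightarrow> 'w \<Rightarrow> real ^ 'm ^ 'n ^ 'l" where
  "avg_noise 0 \<omega> = 0"
| "avg_noise (Suc t) \<omega> = \<beta>1 *\<^sub>R avg_noise t \<omega> + (1 - \<beta>1) *\<^sub>R noise (X (Suc t) \<omega>) (\<xi> (Suc t) \<omega>)"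

lemma step_noise_measurable:
  assumes t: "t \<in> {1..T}"
  shows "(\<lambda>\<omega>. noise (X t \<omega>) (\<xi> t \<omega>)) \<in> borel_measurable (H t)"
  using measurable_compose[OF measurable_Pair[OF H_mono[OF X_adapted[OF t]] \<xi>_measurable[OF t]]
      noise_measurable] by simp

lemma avg_noise_adapted: "t \<le> T \<Longrightarrow> avg_noise t \<in> borel_measurable (H t)"
proof (induction t)
  case (Suc t)
  have [measurable]: "avg_noise t \<in> borel_measurable (H (Suc t))"
    using Suc by (auto intro: H_mono[of _ t])
  have [measurable]: "(\<lambda>\<omega>. noise (X (Suc t) \<omega>) (\<xi> (Suc t) \<omega>)) \<in> borel_measurable (H (Suc t))"
    using Suc.prems by (intro step_noise_measurable) simp
  have "(\<lambda>\<omega>. avg_noise (Suc t) \<omega>) \<in> borel_measurable (H (Suc t))"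
    unfolding avg_noise.simps by measurable
  then show ?case by simp
qed (simp add: avg_noise.simps(1)[abs_def])

lemma avg_noise_second_moment:
  assumes "t \<le> T"
  shows "integrable P (\<lambda>\<omega>. (norm (avg_noise t \<omega> $ l))\<^sup>2)
    \<and> expectation (\<lambda>\<omega>. (norm (avg_noise t \<omega> $ l))\<^sup>2) \<le> (1 - \<beta>1) * (\<sigma> l)\<^sup>2"
  using assms
proof (induction t)
  case 0
  then show ?case using \<beta>1 by simp
next
  case (Suc t)
  let ?s = "Suc t"
  have s: "?s \<in> {1..T}" using Suc.prems by simp
  define U where "U \<omega> = avg_noise t \<omega> $ l" for \<omega>
  define n where "n \<omega> = noise (X ?s \<omega>) (\<xi> ?s \<omega>) $ l" for \<omega>
  \<comment> \<open>The average up to step \<open>t\<close> belongs to the past of step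
    \<open>Suc t\<close>, which makes the cross term vanish in expectation.\<close>
  have U: "U \<in> borel_measurable (H (?s - 1))"
    unfolding U_def using avg_noise_adapted[of t] Suc.prems
    by (auto intro: measurable_compose[OF _ nth_measurable])
  have IH: "integrable P (\<lambda>\<omega>. (norm (U \<omega>))\<^sup>2)" "expectation (\<lambda>\<omega>. (norm (U \<omega>))\<^sup>2) \<le> (1 - \<beta>1) * (\<sigma> l)\<^sup>2"
    using Suc by (auto simp: U_def)
  have n2: "integrable P (\<lambda>\<omega>. (norm (n \<omega>))\<^sup>2)" "expectation (\<lambda>\<omega>. (norm (n \<omega>))\<^sup>2) \<le> (\<sigma> l)\<^sup>2"
    using noise_second_moment[OF s] by (auto simp: n_def)
  have cross: "integrable P (\<lambda>\<omega>. U \<omega> \<bullet> n \<omega>)" "expectation (\<lambda>\<omega>. U \<omega> \<bullet> n \<omega>) = 0"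
    unfolding n_def
    by (rule fresh_noise_uncorrelated[OF subalgebra_H X_adapted[OF s] \<xi>_measurable'[OF s] fresh_step[OF s]
        noise_nth_measurable[of l] noise_nth_moments(1,2) U IH(1) n2(1)[unfolded n_def]])+
  have eq: "(norm (avg_noise ?s \<omega> $ l))\<^sup>2
      = \<beta>1\<^sup>2 * (norm (U \<omega>))\<^sup>2 + 2 * \<beta>1 * (1 - \<beta>1) * (U \<omega> \<bullet> n \<omega>) + (1 - \<beta>1)\<^sup>2 * (norm (n \<omega>))\<^sup>2" for \<omega>
    unfolding avg_noise.simps vector_add_component vector_scaleR_component U_def[symmetric] n_def[symmetric]
    by (rule power2_norm_lincomb)
  have "expectation (\<lambda>\<omega>. (norm (avg_noise ?s \<omega> $ l))\<^sup>2)
      = \<beta>1\<^sup>2 * expectation (\<lambda>\<omega>. (norm (U \<omega>))\<^sup>2) + (1 - \<beta>1)\<^sup>2 * expectation (\<lambda>\<omega>. (norm (n \<omega>))\<^sup>2)"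
    unfolding eq using IH n2 cross by simp
  also have "\<dots> \<le> \<beta>1\<^sup>2 * ((1 - \<beta>1) * (\<sigma> l)\<^sup>2) + (1 - \<beta>1)\<^sup>2 * (\<sigma> l)\<^sup>2"
    using IH n2 by (intro add_mono mult_left_mono) auto
  also have "\<dots> = (1 - \<beta>1) * (\<sigma> l)\<^sup>2 * (\<beta>1\<^sup>2 + (1 - \<beta>1))"
    by (simp add: power2_eq_square algebra_simps)
  also have "\<dots> \<le> (1 - \<beta>1) * (\<sigma> l)\<^sup>2 * 1"
    using \<beta>1 by (intro mult_left_mono) (auto simp: power2_eq_square mult_left_le)
  finally show ?case
    unfolding eq using IH n2 cross by simp
qed

text \<open>Every step has length at most \<open>\<gamma> * r\<close>, so the iterate stays in a
  deterministic ball about \<open>X1\<close>. Smoothness applied from \<open>X1\<close> then bounds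
  its gradient.\<close>

lemma grad_integrable:
  assumes t: "t \<in> {1..T}"
  shows "integrable P (\<lambda>\<omega>. gradient_on S F (X t \<omega>))"
proof -
  define K where "K = L0 + L1 * grad_power (norm (gradient_on S F X1)) q"
  define r where "r = sqrt (real CARD('l)) * u"
  have K: "0 \<le> K"
    using smooth grad_power_nonneg by (auto simp: K_def joint_smooth_def)
  have dist: "norm (X (Suc s) \<omega> - X1) \<le> real s * (\<gamma> * r)" if "s \<le> T" "\<omega> \<in> space P" for s \<omega>
    using that
  proof (induction s)
    case 0
    then show ?case using X_1 by simp
  next
    case (Suc s)
    have "norm (Q (Suc s) \<omega>) \<le> r"
      unfolding r_def by (rule norm_le_of_norm_nth_le) (use Suc.prems orth_norm in \<open>simp add: Q_eq\<close>)
    then have "\<gamma> * norm (Q (Suc s) \<omega>) \<le> \<gamma> * r" using \<gamma> by simp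
    then have "norm (\<gamma> *\<^sub>R Q (Suc s) \<omega>) \<le> \<gamma> * r" using \<gamma> by simp
    moreover have eq: "X (Suc (Suc s)) \<omega> - X1 = (X (Suc s) \<omega> - X1) - \<gamma> *\<^sub>R Q (Suc s) \<omega>"
      using X_eq[of "Suc s" \<omega>] Suc.prems by simp
    ultimately have "norm (X (Suc (Suc s)) \<omega> - X1) \<le> norm (X (Suc s) \<omega> - X1) + \<gamma> * r"
      unfolding eq using norm_triangle_ineq4[of "X (Suc s) \<omega> - X1" "\<gamma> *\<^sub>R Q (Suc s) \<omega>"] by linarith
    then show ?case using Suc by (simp add: algebra_simps)
  qed
  show ?thesis
  proof (rule integrable_const_bound)
    have "norm (gradient_on S F (X t \<omega>)) \<le> norm (gradient_on S F X1) + K * (real (t - 1) * (\<gamma> * r))"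
      if \<omega>: "\<omega> \<in> space P" for \<omega>
    proof -
      have "norm (gradient_on S F X1 - gradient_on S F (X t \<omega>)) \<le> K * norm (X1 - X t \<omega>)"
        using smooth X1 X_S[of t \<omega>] t \<omega> unfolding joint_smooth_def K_def by auto
      also have "\<dots> \<le> K * (real (t - 1) * (\<gamma> * r))"
        using dist[of "t - 1" \<omega>] t \<omega> K by (intro mult_left_mono) (auto simp: norm_minus_commute)
      finally show ?thesis
        using norm_triangle_sub[of "gradient_on S F (X t \<omega>)" "gradient_on S F X1"]
        by (simp add: norm_minus_commute)
    qed
    then show "AE \<omega> in P. norm (gradient_on S F (X t \<omega>))
        \<le> norm (gradient_on S F X1) + K * (real (t - 1) * (\<gamma> * r))" by simp
    have "(\<lambda>\<omega>. gradient_on S F (proj (X t \<omega>))) \<in> borel_measurable P"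
      using measurable_from_subalg[OF subalgebra_H X_adapted[OF t]]
      by (rule measurable_compose[OF _ grad_measurable])
    moreover have "(\<lambda>\<omega>. gradient_on S F (proj (X t \<omega>))) \<in> borel_measurable P
        \<longleftrightarrow> (\<lambda>\<omega>. gradient_on S F (X t \<omega>)) \<in> borel_measurable P"
      by (rule measurable_cong) (use X_S t in \<open>simp add: proj_id\<close>)
    ultimately show "(\<lambda>\<omega>. gradient_on S F (X t \<omega>)) \<in> borel_measurable P" by simp
  qed
qed

lemma grad_nth_integrable:
  assumes t: "t \<in> {1..T}"
  shows "integrable P (\<lambda>\<omega>. norm (gradient_on S F (X t \<omega>) $ l))"
  using integrable_norm[OF integrable_bounded_linear[OF bounded_linear_vec_nth grad_integrable[OF t]]] .

text \<open>This integrates the pathwise bound. In each layer and step the averaged noise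
  contributes \<open>sqrt (1 - \<beta>1)\<close> and the fresh noise \<open>1 - \<beta>2\<close>,
  both times \<open>\<sigma> l\<close>.\<close>

theorem expectation_bound:
  shows "(\<l> - \<gamma> * real CARD('l) * u\<^sup>2 * q * L1 / 2
          - \<gamma> * real CARD('l) * u * (\<l> + u) * q * L1 / (1 - \<beta>1))
        * (\<Sum>t=1..T. \<Sum>l\<in>UNIV. expectation (\<lambda>\<omega>. norm (gradient_on S F (X t \<omega>) $ l)))
    \<le> (F X1 - Fstar) / \<gamma> + (\<l> + u) * (\<Sum>l\<in>UNIV. norm (gradient_on S F X1 $ l)) / (1 - \<beta>1)
      + real T * (\<gamma> * real CARD('l) * u * (\<l> + u) * (L0 + (1 - q) * L1) / (1 - \<beta>1)
                  + \<gamma> * real CARD('l) * u\<^sup>2 * (L0 + (1 - q) * L1) / 2)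
      + real T * ((\<l> + u) * (\<Sum>l\<in>UNIV. \<sigma> l) * (sqrt (1 - \<beta>1) + (1 - \<beta>2)))"
    (is "?c * _ \<le> ?d + real T * ((\<l> + u) * (\<Sum>l\<in>UNIV. \<sigma> l) * ?e)")
proof -
  let ?g = "\<lambda>t \<omega>. gradient_on S F (X t \<omega>)"
  define noise' where "noise' t l \<omega> = norm (avg_noise t \<omega> $ l)
      + (1 - \<beta>2) * norm (noise (X t \<omega>) (\<xi> t \<omega>) $ l)" for t l \<omega>
  have path: "?c * (\<Sum>t=1..T. \<Sum>l\<in>UNIV. norm (?g t \<omega> $ l))
      \<le> ?d + (\<l> + u) * (\<Sum>t=1..T. \<Sum>l\<in>UNIV. noise' t l \<omega>)" if \<omega>: "\<omega> \<in> space P" for \<omega>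
  proof -
    \<comment> \<open>The averaged noise satisfies the recursion demanded of \<open>V\<close>,
      because \<open>noise\<close> at the iterate is \<open>G\<close> minus the true
      gradient.\<close>
    have "avg_noise t \<omega> = \<beta>1 *\<^sub>R avg_noise (t - 1) \<omega> + (1 - \<beta>1) *\<^sub>R (G t \<omega> - ?g t \<omega>)"
      if t: "t \<in> {1..T}" for t
      using G_noise[OF t \<omega>] t by (cases t) auto
    then have "?c * (\<Sum>t=1..T. \<Sum>l\<in>UNIV. norm (?g t \<omega> $ l))
      \<le> (F (X 1 \<omega>) - Fstar) / \<gamma> + (\<l> + u) * (\<Sum>l\<in>UNIV. norm (?g 1 \<omega> $ l)) / (1 - \<beta>1)
        + real T * (\<gamma> * real CARD('l) * u * (\<l> + u) * (L0 + (1 - q) * L1) / (1 - \<beta>1)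
                  + \<gamma> * real CARD('l) * u\<^sup>2 * (L0 + (1 - q) * L1) / 2)
        + (\<l> + u) * (\<Sum>t=1..T. \<Sum>l\<in>UNIV. norm (avg_noise t \<omega> $ l)
            + (1 - \<beta>2) * norm ((G t \<omega> - ?g t \<omega>) $ l))"
      using M_0[OF \<omega>] M_eq[OF _ \<omega>] N_eq[OF _ \<omega>] X_eq[OF _ \<omega>] Q_eq[OF _ \<omega>] orth_inner orth_norm
      by (intro muon_path_bound[where X = "\<lambda>t. X t \<omega>" and G = "\<lambda>t. G t \<omega>" and M = "\<lambda>t. M t \<omega>"
            and N = "\<lambda>t. N t \<omega>" and Q = "\<lambda>t. Q t \<omega>" and V = "\<lambda>t. avg_noise t \<omega>",
            OF subspace_S smooth lower X_S[OF _ \<omega>] T \<gamma> \<beta>1 \<beta>2 pos]) auto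
    also have "(\<Sum>t=1..T. \<Sum>l\<in>UNIV. norm (avg_noise t \<omega> $ l)
            + (1 - \<beta>2) * norm ((G t \<omega> - ?g t \<omega>) $ l)) = (\<Sum>t=1..T. \<Sum>l\<in>UNIV. noise' t l \<omega>)"
      by (intro sum.cong refl) (simp add: noise'_def G_noise \<omega> del: vector_minus_component)
    finally show ?thesis using X_1[OF \<omega>] by simp
  qed
  have noise': "integrable P (noise' t l)" "expectation (noise' t l) \<le> \<sigma> l * ?e"
    if t: "t \<in> {1..T}" for t l
  proof -
    have V: "(\<lambda>\<omega>. avg_noise t \<omega> $ l) \<in> borel_measurable P"
      using measurable_from_subalg[OF subalgebra_H avg_noise_adapted] t
      by (intro measurable_compose[OF _ nth_measurable]) auto
    have n: "(\<lambda>\<omega>. noise (X t \<omega>) (\<xi> t \<omega>) $ l) \<in> borel_measurable P"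
      using measurable_from_subalg[OF subalgebra_H step_noise_measurable[OF t]]
      by (intro measurable_compose[OF _ nth_measurable]) auto
    have "t \<le> T" using t by simp
    note V = expectation_norm_le_sqrt[OF V avg_noise_second_moment[THEN conjunct1, OF this]
        avg_noise_second_moment[THEN conjunct2, OF this]]
    note n = expectation_norm_le_sqrt[OF n noise_second_moment[OF t]]
    show "integrable P (noise' t l)" unfolding noise'_def[abs_def] using V n by simp
    have "expectation (noise' t l) = expectation (\<lambda>\<omega>. norm (avg_noise t \<omega> $ l))
        + (1 - \<beta>2) * expectation (\<lambda>\<omega>. norm (noise (X t \<omega>) (\<xi> t \<omega>) $ l))"
      unfolding noise'_def[abs_def] using V n by simp
    also have "\<dots> \<le> sqrt ((1 - \<beta>1) * (\<sigma> l)\<^sup>2) + (1 - \<beta>2) * sqrt ((\<sigma> l)\<^sup>2)"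
      using V n \<beta>2 by (intro add_mono mult_left_mono) auto
    also have "\<dots> = \<sigma> l * ?e"
      using \<sigma>_nonneg by (simp add: real_sqrt_mult distrib_left mult.commute)
    finally show "expectation (noise' t l) \<le> \<sigma> l * ?e" .
  qed
  have "?c * (\<Sum>t=1..T. \<Sum>l\<in>UNIV. expectation (\<lambda>\<omega>. norm (?g t \<omega> $ l)))
      = expectation (\<lambda>\<omega>. ?c * (\<Sum>t=1..T. \<Sum>l\<in>UNIV. norm (?g t \<omega> $ l)))"
    by (simp add: Bochner_Integration.integral_sum grad_nth_integrable)
  also have "\<dots> \<le> expectation (\<lambda>\<omega>. ?d + (\<l> + u) * (\<Sum>t=1..T. \<Sum>l\<in>UNIV. noise' t l \<omega>))"
    by (intro integral_mono path) (auto intro!: Bochner_Integration.integrable_sum grad_nth_integrable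
        noise' Bochner_Integration.integrable_add integrable_mult_right)
  also have "\<dots> = ?d + (\<l> + u) * (\<Sum>t=1..T. \<Sum>l\<in>UNIV. expectation (noise' t l))"
  proof -
    have "integrable P (\<lambda>\<omega>. (\<l> + u) * (\<Sum>t=1..T. \<Sum>l\<in>UNIV. noise' t l \<omega>))"
      by (intro integrable_mult_right Bochner_Integration.integrable_sum noise')
    then have "expectation (\<lambda>\<omega>. ?d + (\<l> + u) * (\<Sum>t=1..T. \<Sum>l\<in>UNIV. noise' t l \<omega>))
        = ?d + expectation (\<lambda>\<omega>. (\<l> + u) * (\<Sum>t=1..T. \<Sum>l\<in>UNIV. noise' t l \<omega>))"
      by (subst Bochner_Integration.integral_add) (simp_all add: prob_space)
    also have "expectation (\<lambda>\<omega>. (\<l> + u) * (\<Sum>t=1..T. \<Sum>l\<in>UNIV. noise' t l \<omega>))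
        = (\<l> + u) * (\<Sum>t=1..T. \<Sum>l\<in>UNIV. expectation (noise' t l))"
      by (simp add: Bochner_Integration.integral_sum noise')
    finally show ?thesis .
  qed
  also have "\<dots> \<le> ?d + (\<l> + u) * (\<Sum>t=1..T. \<Sum>l\<in>UNIV. \<sigma> l * ?e)"
    using pos by (intro add_left_mono mult_left_mono sum_mono noise') auto
  also have "\<dots> = ?d + real T * ((\<l> + u) * (\<Sum>l\<in>UNIV. \<sigma> l) * ?e)"
    by (simp add: sum_distrib_right)
  finally show ?thesis .
qed

end

subsection \<open>The convergence rate\<close>

text \<open>With these parameters the initial gap over \<open>\<gamma> T * T\<close>, the averaged
  noise \<open>sqrt (1 - \<beta>1 T)\<close> and the drift ratio
  \<open>\<gamma> T / (1 - \<beta>1 T)\<close> all have order \<open>T powr (- 1 / 4)\<close>. The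
  threshold is fixed before the probability space and the run.\<close>

theorem corollary3p5:
  fixes rowset :: "'l::finite \<Rightarrow> 'n::finite set" and colset :: "'l \<Rightarrow> 'm::finite set"
    and S :: "(real ^ 'm ^ 'n ^ 'l) set"
    and \<mu> :: "'x measure"
    and f :: "real ^ 'm ^ 'n ^ 'l \<Rightarrow> 'x \<Rightarrow> real"
    and F :: "real ^ 'm ^ 'n ^ 'l \<Rightarrow> real"
    and X1 :: "real ^ 'm ^ 'n ^ 'l"
    and Fstar L0 L1 q :: real and \<sigma> :: "'l \<Rightarrow> real"
    and J :: nat and ca cb cc :: "nat \<Rightarrow> real"
    and \<gamma>0 \<delta>0 a :: real
    and L \<l> u D SF GF Lhat bJ :: real
    and \<gamma> \<beta>1 \<beta>2 :: "nat \<Rightarrow> real"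
  assumes S: "S = param_space rowset colset"
    and objective: "stochastic_objective S \<mu> f F"
    and lower_bounded: "\<And>X. X \<in> S \<Longrightarrow> F X \<ge> Fstar"
    and smooth: "joint_smooth S F L0 L1 q"
    and variance: "layerwise_variance S \<mu> f F \<sigma>"
    and X1: "X1 \<in> S"
    and J: "J \<ge> 1"
    and ell: "\<l> = (INF s\<in>{0<..1}. ns_scalar ca cb cc J s / s)"
    and ell_bdd: "bdd_below ((\<lambda>s. ns_scalar ca cb cc J s / s) ` {0<..1})"
    and ell_pos: "\<l> > 0"
    and u: "u = (SUP s\<in>{0<..1}. ns_scalar ca cb cc J s / s)"
    and u_finite: "bdd_above ((\<lambda>s. ns_scalar ca cb cc J s / s) ` {0<..1})"
    and "\<gamma>0 > 0" and "\<delta>0 > 0" and "a > 1 / 2"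
    and "\<And>T. \<gamma> T = \<gamma>0 * real T powr (- 3 / 4)"
    and "\<And>T. 1 - \<beta>1 T = \<delta>0 * real T powr (- 1 / 2)"
    and "\<And>T. \<beta>2 T = 1 - (1 - \<beta>1 T) powr a"
    and "L = real CARD('l)"
    and "D = F X1 - Fstar"
    and "SF = (\<Sum>l\<in>UNIV. \<sigma> l)"
    and "GF = (\<Sum>l\<in>UNIV. norm (gradient_on S F X1 $ l))"
    and "Lhat = L0 + (1 - q) * L1"
    and "bJ = \<l> + u"
  shows "\<exists>T0. \<forall>T\<ge>T0.
    \<beta>1 T \<in> {0..1} \<and> \<beta>2 T \<in> {0..1} \<and>
    \<l> - \<gamma> T * L * u\<^sup>2 * q * L1 / 2 - \<gamma> T * L * u * (\<l> + u) * q * L1 / (1 - \<beta>1 T) \<ge> \<l> / 2 \<and>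
    (\<forall>(P :: 'w measure) H \<xi> X.
       fresh_samples P H \<mu> T \<xi> \<longrightarrow>
       muon_run S f (newton_schulz ca cb cc J) (\<gamma> T) (\<beta>1 T) (\<beta>2 T) T X1 (space P) \<xi> X \<longrightarrow>
       (let B = 2 / \<l> *
          ((D / \<gamma>0 + bJ * SF * sqrt \<delta>0 + \<gamma>0 * L * u * bJ * Lhat / \<delta>0) * real T powr (- 1 / 4)
            + bJ * GF / (\<delta>0 * real T powr (1 / 2))
            + sqrt 2 * bJ * SF *
                (\<delta>0 powr ((1 + a) / 2) / real T powr ((1 + a) / 4)
                  + \<delta>0 powr a / real T powr (a / 2))
            + \<gamma>0 * L * u\<^sup>2 * Lhat / (2 * real T powr (3 / 4)))
        in
          (\<forall>t\<in>{1..T}. \<forall>l. integrable P (\<lambda>\<omega>. norm (gradient_on S F (X t \<omega>) $ l))) \<and>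
          (\<forall>t\<in>{1..T}. integrable P (\<lambda>\<omega>. norm (gradient_on S F (X t \<omega>)))) \<and>
          1 / real T * (\<Sum>t=1..T. \<Sum>l\<in>UNIV. \<integral>\<omega>. norm (gradient_on S F (X t \<omega>) $ l) \<partial>P) \<le> B \<and>
          1 / real T * (\<Sum>t=1..T. \<integral>\<omega>. norm (gradient_on S F (X t \<omega>)) \<partial>P) \<le> B))"
proof -
  note \<gamma>_eq = assms(16) and \<beta>1_eq = assms(17) and \<beta>2_eq = assms(18)
  note const = assms(19-24)
  note par = assms(13-15)
  \<comment> \<open>Infimum and supremum bound each quotient; multiplying by the positive
    \<open>s\<close> gives linear bounds on the scalar map.\<close>
  have lo: "\<l> * s \<le> ns_scalar ca cb cc J s" and hi: "ns_scalar ca cb cc J s \<le> u * s"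
    if "0 < s" "s \<le> 1" for s
    using cINF_lower[OF ell_bdd, of s] cSUP_upper[OF _ u_finite, of s] that
    by (simp_all add: ell u field_simps)
  have u_pos: "u > 0" using lo[of 1] hi[of 1] ell_pos by simp
  have subsp: "subspace S" unfolding S by (rule subspace_param_space)

  define A where "A = L * u\<^sup>2 * q * L1 / 2"
  define B where "B = L * u * (\<l> + u) * q * L1"
  have powr0: "(\<lambda>T. real T powr - c) \<longlonglongrightarrow> 0" if "c > 0" for c
    using that by (intro tendsto_neg_powr filterlim_real_sequentially) auto
  have alpha: "1 - \<beta>1 T = \<delta>0 * real T powr - (1 / 2)" for T using \<beta>1_eq[of T] by simp
  have ratio: "\<gamma> T / (1 - \<beta>1 T) = \<gamma>0 / \<delta>0 * real T powr - (1 / 4)" if "1 \<le> T" for T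
  proof -
    have "real T powr - (3 / 4) = real T powr - (1 / 4) * real T powr - (1 / 2)"
      by (simp flip: powr_add)
    then show ?thesis using that par by (simp add: \<gamma>_eq alpha)
  qed
  have "eventually (\<lambda>T. 1 \<le> T) sequentially" by (rule eventually_ge_at_top)
  moreover have "eventually (\<lambda>T. 1 - \<beta>1 T < 1) sequentially"
    unfolding alpha
    by (rule order_tendstoD(2)[OF tendsto_mult_right_zero[OF powr0]]) auto
  \<comment> \<open>Both corrections tend to \<open>0\<close>, so the coefficient tends to
    \<open>\<l>\<close>, which exceeds \<open>\<l> / 2\<close> because it is positive.\<close>
  moreover have "eventually (\<lambda>T. \<l> / 2 < \<l> - \<gamma>0 * real T powr - (3 / 4) * A
      - \<gamma>0 / \<delta>0 * real T powr - (1 / 4) * B) sequentially"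
  proof (rule order_tendstoD(1))
    show "(\<lambda>T. \<l> - \<gamma>0 * real T powr - (3 / 4) * A - \<gamma>0 / \<delta>0 * real T powr - (1 / 4) * B)
        \<longlonglongrightarrow> \<l> - \<gamma>0 * 0 * A - \<gamma>0 / \<delta>0 * 0 * B"
      by (intro tendsto_intros powr0) auto
  qed (use ell_pos in simp)
  ultimately have "eventually (\<lambda>T. 1 \<le> T \<and> 1 - \<beta>1 T < 1 \<and>
      \<l> / 2 \<le> \<l> - \<gamma> T * A - \<gamma> T / (1 - \<beta>1 T) * B) sequentially"
  proof eventually_elim
    case (elim T)
    have "\<gamma> T = \<gamma>0 * real T powr - (3 / 4)" using \<gamma>_eq[of T] by simp
    then show ?case using elim ratio[OF elim(1)] by simp
  qed
  then obtain T0 where T0: "\<And>T. T0 \<le> T \<Longrightarrow> 1 \<le> T \<and> 1 - \<beta>1 T < 1 \<and>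
      \<l> / 2 \<le> \<l> - \<gamma> T * A - \<gamma> T / (1 - \<beta>1 T) * B"
    unfolding eventually_sequentially by blast
  show ?thesis
  proof (intro exI[of _ T0] allI impI conjI)
    fix T assume "T0 \<le> T"
    note T1 = T0[OF this, THEN conjunct1] and small = T0[OF this, THEN conjunct2, THEN conjunct1]
      and coef = T0[OF this, THEN conjunct2, THEN conjunct2]
    have \<gamma>_pos: "\<gamma> T > 0" using T1 par by (simp add: \<gamma>_eq)
    have \<alpha>: "0 < 1 - \<beta>1 T" using T1 par by (simp add: alpha)
    show b1: "\<beta>1 T \<in> {0..1}" using small \<alpha> by simp
    have \<rho>: "0 \<le> (1 - \<beta>1 T) powr a" "(1 - \<beta>1 T) powr a \<le> 1"
      using small \<alpha> par by (auto intro: powr_le1)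
    then show b2: "\<beta>2 T \<in> {0..1}" by (simp add: \<beta>2_eq)
    show coef': "\<l> / 2 \<le> \<l> - \<gamma> T * L * u\<^sup>2 * q * L1 / 2 - \<gamma> T * L * u * (\<l> + u) * q * L1 / (1 - \<beta>1 T)"
      using coef by (simp add: A_def B_def mult.assoc)

    fix P :: "'w measure" and H \<xi> X
    assume fresh: "fresh_samples P H \<mu> T \<xi>"
    assume run: "muon_run S f (newton_schulz ca cb cc J) (\<gamma> T) (\<beta>1 T) (\<beta>2 T) T X1 (space P) \<xi> X"
    obtain G M N Q :: "nat \<Rightarrow> 'w \<Rightarrow> real ^ 'm ^ 'n ^ 'l" where run:
      "\<forall>\<omega>\<in>space P. X 1 \<omega> = X1 \<and> M 0 \<omega> = 0 \<and> (\<forall>t\<in>{1..T}. \<forall>l.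
           G t \<omega> $ l = gradient_on S (\<lambda>Y. f Y (\<xi> t \<omega>)) (X t \<omega>) $ l \<and>
           M t \<omega> $ l = \<beta>1 T *\<^sub>R (M (t - 1) \<omega> $ l) + (1 - \<beta>1 T) *\<^sub>R (G t \<omega> $ l) \<and>
           N t \<omega> $ l = \<beta>2 T *\<^sub>R (M t \<omega> $ l) + (1 - \<beta>2 T) *\<^sub>R (G t \<omega> $ l) \<and>
           Q t \<omega> $ l = newton_schulz ca cb cc J (N t \<omega> $ l) \<and>
           X (t + 1) \<omega> $ l = X t \<omega> $ l - \<gamma> T *\<^sub>R (Q t \<omega> $ l))"
      using run unfolding muon_run_def by blast
    have step: "G t \<omega> $ l = gradient_on S (\<lambda>Y. f Y (\<xi> t \<omega>)) (X t \<omega>) $ l"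
        "M t \<omega> $ l = \<beta>1 T *\<^sub>R (M (t - 1) \<omega> $ l) + (1 - \<beta>1 T) *\<^sub>R (G t \<omega> $ l)"
        "N t \<omega> $ l = \<beta>2 T *\<^sub>R (M t \<omega> $ l) + (1 - \<beta>2 T) *\<^sub>R (G t \<omega> $ l)"
        "Q t \<omega> $ l = newton_schulz ca cb cc J (N t \<omega> $ l)"
        "X (t + 1) \<omega> $ l = X t \<omega> $ l - \<gamma> T *\<^sub>R (Q t \<omega> $ l)"
      if "t \<in> {1..T}" "\<omega> \<in> space P" for t \<omega> l
      using run that by blast+
    interpret stochastic_muon P H \<mu> T \<xi> S f F Fstar L0 L1 q \<sigma> "newton_schulz ca cb cc J" \<l> u
      "\<gamma> T" "\<beta>1 T" "\<beta>2 T" X1 X G M N Q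
    proof
      show "subspace S" "stochastic_objective S \<mu> f F" "joint_smooth S F L0 L1 q"
        "layerwise_variance S \<mu> f F \<sigma>" "X1 \<in> S" "fresh_samples P H \<mu> T \<xi>" "1 \<le> T" "0 < \<gamma> T"
        "0 \<le> \<l>" "0 \<le> u"
        using subsp objective smooth variance X1 fresh T1 \<gamma>_pos ell_pos u_pos by simp_all
      show "0 \<le> \<beta>1 T" "\<beta>1 T < 1" "0 \<le> \<beta>2 T" "\<beta>2 T \<le> 1"
        using b1 b2 \<alpha> by simp_all
      show "Fstar \<le> F Y" if "Y \<in> S" for Y using that by (rule lower_bounded)
      show "newton_schulz ca cb cc J \<in> borel_measurable borel"
        by (rule borel_measurable_newton_schulz)
      show "\<l> * norm Z \<le> Z \<bullet> newton_schulz ca cb cc J Z" "norm (newton_schulz ca cb cc J Z) \<le> u"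
        for Z :: "real ^ 'm ^ 'n"
        using newton_schulz_bounds[of \<l> ca cb cc J u Z] lo hi ell_pos u_pos by auto
      show "(\<chi> l. newton_schulz ca cb cc J (Y $ l)) \<in> S" if "Y \<in> S" for Y
        unfolding S param_space_def mem_Collect_eq vec_lambda_beta
      proof (intro allI impI)
        fix l i j assume "i \<notin> rowset l \<or> j \<notin> colset l"
        then show "newton_schulz ca cb cc J (Y $ l) $ i $ j = 0"
          using that
          by (intro newton_schulz_support[of "rowset l" "colset l" "Y $ l"]) (auto simp: S param_space_def)
      qed
    next
      fix t \<omega> assume t: "t \<in> {1..T}" and \<omega>: "\<omega> \<in> space P"
      show "G t \<omega> = gradient_on S (\<lambda>Y. f Y (\<xi> t \<omega>)) (X t \<omega>)"
        "M t \<omega> = \<beta>1 T *\<^sub>R M (t - 1) \<omega> + (1 - \<beta>1 T) *\<^sub>R G t \<omega>"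
        "N t \<omega> = \<beta>2 T *\<^sub>R M t \<omega> + (1 - \<beta>2 T) *\<^sub>R G t \<omega>"
        "Q t \<omega> = (\<chi> l. newton_schulz ca cb cc J (N t \<omega> $ l))"
        "X (t + 1) \<omega> = X t \<omega> - \<gamma> T *\<^sub>R Q t \<omega>"
        by (rule vec_eq_iff[THEN iffD2], simp add: step[OF t \<omega>, simplified])+
    qed (use run in blast)+

    define h where "h t = (\<Sum>l\<in>UNIV. expectation (\<lambda>\<omega>. norm (gradient_on S F (X t \<omega>) $ l)))" for t
    define W where "W = (D / \<gamma>0 + bJ * SF * sqrt \<delta>0 + \<gamma>0 * L * u * bJ * Lhat / \<delta>0) * real T powr (- 1 / 4)
            + bJ * GF / (\<delta>0 * real T powr (1 / 2))
            + sqrt 2 * bJ * SF *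
                (\<delta>0 powr ((1 + a) / 2) / real T powr ((1 + a) / 4)
                  + \<delta>0 powr a / real T powr (a / 2))
            + \<gamma>0 * L * u\<^sup>2 * Lhat / (2 * real T powr (3 / 4))"
    \<comment> \<open>The right-hand side of \<open>expectation_bound\<close> in the abbreviations
      of the statement; \<open>W\<close> is the target bracket.\<close>
    define R where "R = D / \<gamma> T + bJ * GF / (1 - \<beta>1 T)
      + real T * (\<gamma> T * L * u * bJ * Lhat / (1 - \<beta>1 T) + \<gamma> T * L * u\<^sup>2 * Lhat / 2)
      + real T * (bJ * SF * (sqrt (1 - \<beta>1 T) + (1 - \<beta>2 T)))"
    have "\<l> / 2 * (\<Sum>t=1..T. h t)
        \<le> (\<l> - \<gamma> T * L * u\<^sup>2 * q * L1 / 2 - \<gamma> T * L * u * (\<l> + u) * q * L1 / (1 - \<beta>1 T)) * (\<Sum>t=1..T. h t)"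
      by (intro mult_right_mono coef' sum_nonneg) (auto simp: h_def sum_nonneg)
    also have "\<dots> \<le> R"
      using expectation_bound unfolding R_def h_def const .
    finally have sum_le: "(\<Sum>t=1..T. h t) \<le> 2 / \<l> * R"
      using ell_pos by (simp add: field_simps)
    have bJ: "0 < bJ" and SF: "0 \<le> SF"
      using ell_pos u_pos \<sigma>_nonneg by (auto simp: const sum_nonneg)
    have Tpos: "0 < real T" using T1 by simp
    have "1 / real T * R = D / (\<gamma> T * real T) + bJ * GF / ((1 - \<beta>1 T) * real T)
        + (\<gamma> T / (1 - \<beta>1 T) * (L * u * bJ * Lhat) + \<gamma> T * L * u\<^sup>2 * Lhat / 2)
        + bJ * SF * (sqrt (1 - \<beta>1 T) + (1 - \<beta>1 T) powr a)"
      using Tpos by (simp add: R_def \<beta>2_eq distrib_left mult.commute[of "real T"] mult.assoc)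
    also have "\<gamma> T * real T = \<gamma>0 * real T powr (1 / 4)"
      using Tpos powr_add[of "real T" "- (3 / 4)" 1] by (simp add: \<gamma>_eq)
    also have "(1 - \<beta>1 T) * real T = \<delta>0 * real T powr (1 / 2)"
      using Tpos powr_add[of "real T" "- (1 / 2)" 1] by (simp add: alpha)
    also have "\<gamma> T / (1 - \<beta>1 T) = \<gamma>0 / \<delta>0 * real T powr - (1 / 4)" by (rule ratio[OF T1])
    also have "sqrt (1 - \<beta>1 T) = sqrt \<delta>0 * real T powr - (1 / 4)"
      using Tpos by (simp add: alpha real_sqrt_mult powr_powr flip: powr_half_sqrt)
    also have "(1 - \<beta>1 T) powr a = \<delta>0 powr a / real T powr (a / 2)"
    proof -
      have "(1 - \<beta>1 T) powr a = \<delta>0 powr a * real T powr (- (1 / 2) * a)"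
        unfolding alpha using par by (simp only: powr_mult powr_powr powr_ge_zero less_imp_le)
      also have "- (1 / 2) * a = - (a / 2)" by simp
      finally show ?thesis by (simp only: powr_minus_divide times_divide_eq_right mult_1_right)
    qed
    also have "D / (\<gamma>0 * real T powr (1 / 4)) + bJ * GF / (\<delta>0 * real T powr (1 / 2))
        + (\<gamma>0 / \<delta>0 * real T powr - (1 / 4) * (L * u * bJ * Lhat) + \<gamma> T * L * u\<^sup>2 * Lhat / 2)
        + bJ * SF * (sqrt \<delta>0 * real T powr - (1 / 4) + \<delta>0 powr a / real T powr (a / 2))
      = (D / \<gamma>0 + bJ * SF * sqrt \<delta>0 + \<gamma>0 * L * u * bJ * Lhat / \<delta>0) * real T powr (- 1 / 4)
        + bJ * GF / (\<delta>0 * real T powr (1 / 2)) + bJ * SF * (\<delta>0 powr a / real T powr (a / 2))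
        + \<gamma>0 * L * u\<^sup>2 * Lhat / (2 * real T powr (3 / 4))"
    proof -
      \<comment> \<open>Naming this power once leaves an identity that field arithmetic can
        settle.\<close>
      define x where "x = real T powr - (1 / 4)"
      have eqs: "real T powr (1 / 4) = 1 / x" "real T powr (- 1 / 4) = x" "real T powr - (1 / 4) = x"
        by (simp_all add: x_def powr_minus_divide)
      have \<gamma>: "\<gamma> T = \<gamma>0 / real T powr (3 / 4)" by (simp add: \<gamma>_eq powr_minus_divide)
      show ?thesis
        unfolding eqs \<gamma> by (simp add: algebra_simps)
    qed
    also have "\<dots> \<le> W"
    proof -
      \<comment> \<open>The second noise term so far has factor \<open>1\<close>. The stated bracket
        is larger by the factor \<open>sqrt 2\<close> and by a further nonnegative summand.\<close>
      have "1 * (bJ * SF) * (\<delta>0 powr a / real T powr (a / 2))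
          \<le> sqrt 2 * (bJ * SF) * (\<delta>0 powr ((1 + a) / 2) / real T powr ((1 + a) / 4)
                  + \<delta>0 powr a / real T powr (a / 2))"
        using bJ SF by (intro mult_mono mult_right_mono) auto
      then show ?thesis by (simp add: W_def mult.assoc)
    qed
    finally have RW: "1 / real T * R \<le> W" .
    have "1 / real T * (\<Sum>t=1..T. h t) \<le> 1 / real T * (2 / \<l> * R)"
      using sum_le by (intro mult_left_mono) auto
    also have "\<dots> = 2 / \<l> * (1 / real T * R)" by simp
    also have "\<dots> \<le> 2 / \<l> * W" using RW ell_pos by (intro mult_left_mono) auto
    finally have main: "1 / real T * (\<Sum>t=1..T. h t) \<le> 2 / \<l> * W" .
    \<comment> \<open>The whole gradient norm is at most the sum of its block norms, so the second
      average inherits the bound of the first.\<close>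
    have norm_le: "expectation (\<lambda>\<omega>. norm (gradient_on S F (X t \<omega>))) \<le> h t" if t: "t \<in> {1..T}" for t
    proof -
      have "expectation (\<lambda>\<omega>. norm (gradient_on S F (X t \<omega>)))
          \<le> expectation (\<lambda>\<omega>. \<Sum>l\<in>UNIV. norm (gradient_on S F (X t \<omega>) $ l))"
        by (intro integral_mono norm_le_sum_norm_nth integrable_norm Bochner_Integration.integrable_sum
            grad_integrable grad_nth_integrable t)
      then show ?thesis
        unfolding h_def by (subst (asm) Bochner_Integration.integral_sum) (auto intro: grad_nth_integrable[OF t])
    qed
    have "1 / real T * (\<Sum>t=1..T. expectation (\<lambda>\<omega>. norm (gradient_on S F (X t \<omega>))))
        \<le> 1 / real T * (\<Sum>t=1..T. h t)"
      by (intro mult_left_mono sum_mono norm_le) auto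
    with main grad_integrable grad_nth_integrable
    show "let B = 2 / \<l> *
          ((D / \<gamma>0 + bJ * SF * sqrt \<delta>0 + \<gamma>0 * L * u * bJ * Lhat / \<delta>0) * real T powr (- 1 / 4)
            + bJ * GF / (\<delta>0 * real T powr (1 / 2))
            + sqrt 2 * bJ * SF *
                (\<delta>0 powr ((1 + a) / 2) / real T powr ((1 + a) / 4)
                  + \<delta>0 powr a / real T powr (a / 2))
            + \<gamma>0 * L * u\<^sup>2 * Lhat / (2 * real T powr (3 / 4)))
        in
          (\<forall>t\<in>{1..T}. \<forall>l. integrable P (\<lambda>\<omega>. norm (gradient_on S F (X t \<omega>) $ l))) \<and>
          (\<forall>t\<in>{1..T}. integrable P (\<lambda>\<omega>. norm (gradient_on S F (X t \<omega>)))) \<and>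
          1 / real T * (\<Sum>t=1..T. \<Sum>l\<in>UNIV. \<integral>\<omega>. norm (gradient_on S F (X t \<omega>) $ l) \<partial>P) \<le> B \<and>
          1 / real T * (\<Sum>t=1..T. \<integral>\<omega>. norm (gradient_on S F (X t \<omega>)) \<partial>P) \<le> B"
      unfolding Let_def W_def[symmetric] h_def[symmetric] by (auto intro: order_trans)
  qed
qed

end
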